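(* Let $G$ be a finite simple graph with two distinct non-adjacent vertices $u$ and $v$. Assume there are $L,R\subseteq V(G)$ such that $L\cup R=V(G)$, $L\cap R=\{u,v\}$, and $E(G)=E(G[L])\cup E(G[R])$. Suppose there is a path from $u$ to $v$ in $G[L]$ and a path from $u$ to $v$ in $G[R]$, and that both $I_{G[L]}$ and $I_{G[R]}$ have generating sets that are slow-varying with respect to $u$ and $v$. Then $$\mu(G)\le \max\{\,2\mu(G[L])-2,\ 2\mu(G[R])-2,\ \mu(G[L]+uv),\ \mu(G[R]+uv)\,\}.$$ Moreover, let $\mathbf{F}_L,\mathbf{F}_R$ be binomial generating sets of $I_{G[L]},I_{G[R]}$ that are slow-varying with respect to $u$ and $v$, and let $\mathbf{F}_{L+uv},\mathbf{F}_{R+uv}$ be binomial generating sets of $I_{G[L]+uv},I_{G[R]+uv}$. Then the cut ideal $I_G$ is generated by the union of (i) the lifts of the generators in $\mathbf{F}_{L+uv}$; (ii) the lifts of the generators in $\mathbf{F}_{R+uv}$; (iii) the joins of generators $q_1-q_2$ of $I_{G[L]}$ from $\mathbf{F}_L$ and $q_3-q_4$ of $I_{G[R]}$ from $\mathbf{F}_R$ such that $|h_{u,v}(q_1)-h_{u,v}(q_2)|=|h_{u,v}(q_3)-h_{u,v}(q_4)|=2$; (iv) the quadratic reordering binomials.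
   Context: Let $\mathbb{K}$ be a field; graphs are finite and simple. $G[S]$ is the induced subgraph of $G$ on $S$, and $H+uv$ is $H$ with the edge $uv$ added. Cut ideals. A cut $A\mid B=B\mid A$ of a graph $G$ is an unordered partition of $V(G)$ into two (possibly empty) parts. An edge $ij$ is in $A\mid B$ if its endpoints lie in different parts. The cut ideal $I_G$ is the kernel of the $\mathbb{K}$-algebra homomorphism $\phi_G:\mathbb{K}[q_{A\mid B}: A\mid B\text{ a cut of }G]\to\mathbb{K}[s_{ij},t_{ij}: ij\in E(G)]$, $q_{A\mid B}\mapsto\prod_{ij\text{ in }A\mid B}s_{ij}\prod_{ij\text{ not in }A\mid B}t_{ij}$. $\mu(G)$ is the largest degree of a minimal generator of $I_G$, i.e. the least $d\ge0$ such that $I_G$ is generated by polynomials of degree at most $d$. Height and slow-varying. For vertices $u,v$ and a monomial $q=q_{A_1\mid B_1}\cdots q_{A_n\mid B_n}$, the height $h_{u,v}(q)$ is the number of indices $i$ (with multiplicity) such that $u$ and $v$ are in different parts of $A_i\mid B_i$. A binomial here is a difference of two monomials of the same degree in the variables $q_{A\mid B}$. A generating set of $I_G$ consisting of binomials $m_i-m_i'$ is slow-varying with respect to $u$ and $v$ if $|h_{u,v}(m_i)-h_{u,v}(m_i')|\le 2$ for all $i$. Lifts, joins, reorderings. For $S\subseteq V(G)$, the restriction of a cut $C\mid D$ of $G$ to $S$ is the cut $C\cap S\mid D\cap S$ of $G[S]$; the restriction of a monomial is obtained by restricting each factor. A lift of a generator in $\mathbf{F}_{L+uv}$ is a binomial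 $\prod_{i=1}^m q_{C_i\mid D_i}-\prod_{i=1}^m q_{C_i'\mid D_i'}$ in the variables of $G$, with factors in each product ordered so that $h_{u,v}(q_{C_1\mid D_1})\ge\cdots\ge h_{u,v}(q_{C_m\mid D_m})$ and likewise for the primed factors, such that $\prod_i q_{C_i\cap L\mid D_i\cap L}-\prod_i q_{C_i'\cap L\mid D_i'\cap L}\in\mathbf{F}_{L+uv}$ and $C_i\cap R\mid D_i\cap R=C_i'\cap R\mid D_i'\cap R$ for all $i$. Lifts of generators in $\mathbf{F}_{R+uv}$ are defined in the same way with $L$ and $R$ exchanged. Let $M$ be the maximal degree of a binomial in $\mathbf{F}_L\cup\mathbf{F}_R$. A join of $q_1-q_2$ (with $\pm(q_1-q_2)\in\mathbf{F}_L$) and $q_3-q_4$ (with $\pm(q_3-q_4)\in\mathbf{F}_R$) is a binomial $Q-Q'$ in the variables of $G$, of degree at most $2M-2$, with $h_{u,v}(Q)\ne h_{u,v}(Q')$, such that for some monomials $p$ (in the variables of $G[L]$) and $r$ (in the variables of $G[R]$) the restrictions of $Q$ and $Q'$ to $L$ are $p\,q_1$ and $p\,q_2$, and the restrictions of $Q$ and $Q'$ to $R$ are $r\,q_3$ and $r\,q_4$. A quadratic reordering binomial is $q_{C_1\mid D_1}q_{C_2\mid D_2}-q_{C_1'\mid D_1'}q_{C_2'\mid D_2'}$ in the variables of $G$ with $C_1\cap L=C_1'\cap L$, $C_2\cap L=C_2'\cap L$, $C_1\cap R=C_2'\cap R$, $C_2\cap R=C_1'\cap R$ (for suitable choices of the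 order of the two parts of each cut). *)

theory Defs
  imports
    "HOL-Library.Poly_Mapping"
    "HOL-Library.Multiset"
    "HOL-Library.Extended_Nat"
    "HOL-Algebra.RingHom"
begin

section \<open>Polynomials\<close>

text \<open>
  A monomial is the finite multiset of its factors, so that \<^term>\<open>{#x, x, y#}\<close> stands for
  $x^2 y$, multiset union is multiplication of monomials, and \<^const>\<open>size\<close> is the degree.
  A polynomial is a finitely supported map from monomials to coefficients; the multiplication
  that \<^theory>\<open>HOL-Library.Poly_Mapping\<close> puts on this type is the convolution product.
\<close>

type_synonym 'x monomial = "'x multiset"
type_synonym ('x, 'k) mpoly = "'x multiset \<Rightarrow>\<^sub>0 'k"

definition monom :: "'x monomial \<Rightarrow> ('x, 'k::field) mpoly" where
  "monom m = Poly_Mapping.single m 1"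

definition var :: "'x \<Rightarrow> ('x, 'k::field) mpoly" where
  "var x = monom {#x#}"

text \<open>Total degree; the zero polynomial gets degree 0.\<close>

definition deg :: "('x, 'k::field) mpoly \<Rightarrow> nat" where
  "deg p = Max (insert 0 (size ` Poly_Mapping.keys p))"

text \<open>\<open>poly_ring X\<close> is $K[x : x \in X]$.\<close>

definition poly_ring :: "'x set \<Rightarrow> ('x, 'k::field) mpoly ring" where
  "poly_ring X =
     \<lparr>carrier = {p. \<forall>m \<in> Poly_Mapping.keys p. set_mset m \<subseteq> X},
      monoid.mult = (*), one = 1, zero = 0, add = (+)\<rparr>"

text \<open>The $K$-algebra homomorphism that sends each variable \<open>x\<close> to \<open>f x\<close>.\<close>

definition poly_hom :: "('x \<Rightarrow> ('y, 'k) mpoly) \<Rightarrow> ('x, 'k) mpoly \<Rightarrow> ('y, 'k::field) mpoly" where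
  "poly_hom f p =
     (\<Sum>m \<in> Poly_Mapping.keys p.
        Poly_Mapping.single {#} (Poly_Mapping.lookup p m) * prod_mset (image_mset f m))"


section \<open>Graphs and cuts\<close>

record 'a graph =
  verts :: "'a set"
  edges :: "'a set set"

definition simple_graph :: "'a graph \<Rightarrow> bool" where
  "simple_graph G \<longleftrightarrow> finite (verts G) \<and>
     (\<forall>e \<in> edges G. \<exists>i \<in> verts G. \<exists>j \<in> verts G. i \<noteq> j \<and> e = {i, j})"

definition induced :: "'a graph \<Rightarrow> 'a set \<Rightarrow> 'a graph" where
  "induced G S = \<lparr>verts = S, edges = {e \<in> edges G. e \<subseteq> S}\<rparr>"

definition add_edge :: "'a \<Rightarrow> 'a \<Rightarrow> 'a graph \<Rightarrow> 'a graph" where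
  "add_edge u v G = \<lparr>verts = verts G, edges = insert {u, v} (edges G)\<rparr>"

definition is_path :: "'a graph \<Rightarrow> 'a \<Rightarrow> 'a list \<Rightarrow> 'a \<Rightarrow> bool" where
  "is_path G u xs v \<longleftrightarrow> xs \<noteq> [] \<and> hd xs = u \<and> last xs = v \<and> distinct xs \<and> set xs \<subseteq> verts G \<and>
     (\<forall>i. Suc i < length xs \<longrightarrow> {xs ! i, xs ! Suc i} \<in> edges G)"

text \<open>The unordered partition $A \mid B$ is the set \<open>{A, B}\<close> of its two parts.\<close>

type_synonym 'a cut = "'a set set"

definition cuts :: "'a graph \<Rightarrow> 'a cut set" where
  "cuts G = {{A, B} | A B. A \<union> B = verts G \<and> A \<inter> B = {}}"

definition separates :: "'a cut \<Rightarrow> 'a \<Rightarrow> 'a \<Rightarrow> bool" where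
  "separates c i j \<longleftrightarrow> (\<exists>A \<in> c. \<exists>B \<in> c. A \<noteq> B \<and> i \<in> A \<and> j \<in> B)"

definition in_cut :: "'a set \<Rightarrow> 'a cut \<Rightarrow> bool" where
  "in_cut e c \<longleftrightarrow> (\<exists>i j. e = {i, j} \<and> separates c i j)"

definition restrict_cut :: "'a set \<Rightarrow> 'a cut \<Rightarrow> 'a cut" where
  "restrict_cut S c = (\<lambda>A. A \<inter> S) ` c"

definition height :: "'a \<Rightarrow> 'a \<Rightarrow> 'a cut monomial \<Rightarrow> nat" where
  "height u v m = size (filter_mset (\<lambda>c. separates c u v) m)"

definition cut_monomials :: "'a graph \<Rightarrow> 'a cut monomial set" where
  "cut_monomials G = {m. set_mset m \<subseteq> cuts G}"


section \<open>Cut ideals\<close>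

datatype 'a st_var = S "'a set" | T "'a set"

definition cut_hom :: "'a graph \<Rightarrow> ('a cut, 'k) mpoly \<Rightarrow> ('a st_var, 'k::field) mpoly" where
  "cut_hom G = poly_hom (\<lambda>c. (\<Prod>e \<in> {e \<in> edges G. in_cut e c}. var (S e)) *
                             (\<Prod>e \<in> {e \<in> edges G. \<not> in_cut e c}. var (T e)))"

definition cut_ideal :: "'a graph \<Rightarrow> ('a cut, 'k::field) mpoly set" where
  "cut_ideal G =
     a_kernel (poly_ring (cuts G)) (poly_ring (S ` edges G \<union> T ` edges G)) (cut_hom G)"

definition generates_cut_ideal :: "('a cut, 'k::field) mpoly set \<Rightarrow> 'a graph \<Rightarrow> bool" where
  "generates_cut_ideal F G \<longleftrightarrow>
     F \<subseteq> carrier (poly_ring (cuts G)) \<and> Idl\<^bsub>poly_ring (cuts G)\<^esub> F = cut_ideal G"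

text \<open>The type argument records the coefficient field.\<close>

definition mu :: "'k::field itself \<Rightarrow> 'a graph \<Rightarrow> nat" where
  "mu _ G = (LEAST d. \<exists>F :: ('a cut, 'k) mpoly set.
                        generates_cut_ideal F G \<and> (\<forall>f \<in> F. deg f \<le> d))"

definition binomial_generators :: "'a graph \<Rightarrow> ('a cut, 'k::field) mpoly set \<Rightarrow> bool" where
  "binomial_generators G F \<longleftrightarrow> generates_cut_ideal F G \<and>
     (\<forall>f \<in> F. \<exists>m \<in> cut_monomials G. \<exists>m' \<in> cut_monomials G.
        size m = size m' \<and> f = monom m - monom m')"

text \<open>A nonzero difference of two monomials determines the unordered pair of monomials, so the
  existential choice of \<open>m\<close> and \<open>m'\<close> is harmless.\<close>

definition slow_varying_generators ::
    "'a \<Rightarrow> 'a \<Rightarrow> 'a graph \<Rightarrow> ('a cut, 'k::field) mpoly set \<Rightarrow> bool" where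
  "slow_varying_generators u v G F \<longleftrightarrow> generates_cut_ideal F G \<and>
     (\<forall>f \<in> F. \<exists>m \<in> cut_monomials G. \<exists>m' \<in> cut_monomials G.
        size m = size m' \<and> f = monom m - monom m' \<and>
        \<bar>int (height u v m) - int (height u v m')\<bar> \<le> 2)"


section \<open>Lifts, joins and reorderings\<close>

text \<open>\<open>lifts G u v L R F\<close> are the lifts of the generators \<open>F\<close> living on \<open>L\<close>. The lists \<open>cs\<close> and
  \<open>cs'\<close> are the two products with their factors in the required order.\<close>

definition lifts ::
    "'a graph \<Rightarrow> 'a \<Rightarrow> 'a \<Rightarrow> 'a set \<Rightarrow> 'a set \<Rightarrow> ('a cut, 'k::field) mpoly set
      \<Rightarrow> ('a cut, 'k) mpoly set" where
  "lifts G u v L R F =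
     {monom (mset cs) - monom (mset cs') | cs cs'.
        set cs \<subseteq> cuts G \<and> set cs' \<subseteq> cuts G \<and> length cs = length cs' \<and>
        sorted_wrt (\<ge>) (map (\<lambda>c. height u v {#c#}) cs) \<and>
        sorted_wrt (\<ge>) (map (\<lambda>c. height u v {#c#}) cs') \<and>
        monom (mset (map (restrict_cut L) cs)) - monom (mset (map (restrict_cut L) cs')) \<in> F \<and>
        (\<forall>i < length cs. restrict_cut R (cs ! i) = restrict_cut R (cs' ! i))}"

text \<open>The maximal degree is taken in \<^typ>\<open>enat\<close>, as \<open>F\<close> is not required to have bounded degrees.\<close>

definition max_degree :: "('x, 'k::field) mpoly set \<Rightarrow> enat" where
  "max_degree F = (SUP f \<in> F. enat (deg f))"

text \<open>In \<open>is_join\<close>, \<open>Q\<close> and \<open>Q'\<close> have different heights, hence are different monomials of the same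
  degree, and \<^term>\<open>size Q\<close> is the degree of their difference.\<close>

definition is_join ::
    "'a graph \<Rightarrow> 'a \<Rightarrow> 'a \<Rightarrow> 'a set \<Rightarrow> 'a set \<Rightarrow> enat \<Rightarrow>
      'a cut monomial \<Rightarrow> 'a cut monomial \<Rightarrow> 'a cut monomial \<Rightarrow> 'a cut monomial \<Rightarrow>
      'a cut monomial \<Rightarrow> 'a cut monomial \<Rightarrow> bool" where
  "is_join G u v L R M q\<^sub>1 q\<^sub>2 q\<^sub>3 q\<^sub>4 Q Q' \<longleftrightarrow>
     Q \<in> cut_monomials G \<and> Q' \<in> cut_monomials G \<and> size Q = size Q' \<and>
     enat (size Q) \<le> 2 * M - 2 \<and>
     height u v Q \<noteq> height u v Q' \<and>
     (\<exists>p \<in> cut_monomials (induced G L). \<exists>r \<in> cut_monomials (induced G R).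
        image_mset (restrict_cut L) Q = p + q\<^sub>1 \<and> image_mset (restrict_cut L) Q' = p + q\<^sub>2 \<and>
        image_mset (restrict_cut R) Q = r + q\<^sub>3 \<and> image_mset (restrict_cut R) Q' = r + q\<^sub>4)"

definition up_to_sign :: "('x, 'k::field) mpoly set \<Rightarrow> 'x monomial \<Rightarrow> 'x monomial \<Rightarrow> bool" where
  "up_to_sign F q q' \<longleftrightarrow> monom q - monom q' \<in> F \<or> - (monom q - monom q') \<in> F"

definition joins ::
    "'a graph \<Rightarrow> 'a \<Rightarrow> 'a \<Rightarrow> 'a set \<Rightarrow> 'a set \<Rightarrow> ('a cut, 'k::field) mpoly set
      \<Rightarrow> ('a cut, 'k) mpoly set \<Rightarrow> ('a cut, 'k) mpoly set" where
  "joins G u v L R F\<^sub>L F\<^sub>R =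
     {monom Q - monom Q' | Q Q' q\<^sub>1 q\<^sub>2 q\<^sub>3 q\<^sub>4.
        up_to_sign F\<^sub>L q\<^sub>1 q\<^sub>2 \<and> up_to_sign F\<^sub>R q\<^sub>3 q\<^sub>4 \<and>
        \<bar>int (height u v q\<^sub>1) - int (height u v q\<^sub>2)\<bar> = 2 \<and>
        \<bar>int (height u v q\<^sub>3) - int (height u v q\<^sub>4)\<bar> = 2 \<and>
        is_join G u v L R (max_degree (F\<^sub>L \<union> F\<^sub>R)) q\<^sub>1 q\<^sub>2 q\<^sub>3 q\<^sub>4 Q Q'}"

definition reorderings ::
    "'a graph \<Rightarrow> 'a set \<Rightarrow> 'a set \<Rightarrow> ('a cut, 'k::field) mpoly set" where
  "reorderings G L R =
     {monom {#{C\<^sub>1, D\<^sub>1}, {C\<^sub>2, D\<^sub>2}#} - monom {#{C\<^sub>1', D\<^sub>1'}, {C\<^sub>2', D\<^sub>2'}#}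
        | C\<^sub>1 D\<^sub>1 C\<^sub>2 D\<^sub>2 C\<^sub>1' D\<^sub>1' C\<^sub>2' D\<^sub>2'.
        {{C\<^sub>1, D\<^sub>1}, {C\<^sub>2, D\<^sub>2}, {C\<^sub>1', D\<^sub>1'}, {C\<^sub>2', D\<^sub>2'}} \<subseteq> cuts G \<and>
        C\<^sub>1 \<inter> L = C\<^sub>1' \<inter> L \<and> C\<^sub>2 \<inter> L = C\<^sub>2' \<inter> L \<and>
        C\<^sub>1 \<inter> R = C\<^sub>2' \<inter> R \<and> C\<^sub>2 \<inter> R = C\<^sub>1' \<inter> R}"

end

theory Submission
  imports Defs
begin

text \<open>
  A set of binomials generates a cut ideal iff the corresponding moves on monomials connect every
  fibre of the monomial map. A cut of \<open>G\<close> is a pair of cuts of \<open>G[L]\<close> and \<open>G[R]\<close> that agree on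
  whether \<open>u\<close> and \<open>v\<close> are separated, so up to reorderings a monomial of \<open>G\<close> is a pair of monomials
  of \<open>G[L]\<close> and \<open>G[R]\<close> with equal degrees and equal heights. Two monomials of a fibre with equal
  heights restrict to fibres of \<open>G[L] + uv\<close> and \<open>G[R] + uv\<close> and are connected by lifts and
  reorderings. The heights in a fibre have the same parity, since \<open>u\<close> and \<open>v\<close> are joined by a path;
  if they differ, slow variation forces the walks in both restricted fibres to contain a move that
  raises the height from its initial value by exactly 2, and these two moves can be performed
  simultaneously by a join.
\<close>

section \<open>Ideals of polynomial rings\<close>

text \<open>A cut of \<open>G[L]\<close> and a cut of \<open>G[R]\<close> glue only if they treat
  \<open>u\<close> and \<open>v\<close> alike, so a move on one side lifts to \<open>G\<close> with
  the other side fixed only if it preserves the height. Adding the edge \<open>uv\<close> puts the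
  height among the fibre invariants, and therefore the generators of \<open>G[L] + uv\<close> and
  \<open>G[R] + uv\<close> lift. A change of height must happen on both sides at once and by the
  same amount; parity and slow variation leave 2 as the only nonzero amount for a single move, so a
  move on the left can be matched with one on the right. The degree bound needs generating sets
  whose degrees are controlled. Moves preserve degree, so a binomial generating set can be truncated
  at \<open>mu\<close> without losing connectivity, and truncation preserves slow variation. That
  \<open>mu\<close> is attained at all rests on Dickson's lemma. Reorderings have degree 2, which is
  within the bound because \<open>mu\<close> of each side is at least 2.\<close>

lemma poly_ring_simps [simp]:
  "zero (poly_ring X) = 0" "one (poly_ring X) = 1"
  "p \<oplus>\<^bsub>poly_ring X\<^esub> q = p + q" "p \<otimes>\<^bsub>poly_ring X\<^esub> q = p * q"
  by (simp_all add: poly_ring_def)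

lemma carrier_poly_ring:
  "p \<in> carrier (poly_ring X) \<longleftrightarrow> (\<forall>m \<in> Poly_Mapping.keys p. set_mset m \<subseteq> X)"
  by (simp add: poly_ring_def)

lemma carrier_poly_ring_add:
  assumes "p \<in> carrier (poly_ring X)" "q \<in> carrier (poly_ring X)"
  shows "p + q \<in> carrier (poly_ring X)"
  using assms Poly_Mapping.keys_add[of p q] unfolding carrier_poly_ring by blast

lemma carrier_poly_ring_uminus:
  assumes "p \<in> carrier (poly_ring X)"
  shows "- p \<in> carrier (poly_ring X)"
  using assms unfolding carrier_poly_ring by (simp add: in_keys_iff)

lemma carrier_poly_ring_mult:
  assumes "p \<in> carrier (poly_ring X)" "q \<in> carrier (poly_ring X)"
  shows "p * q \<in> carrier (poly_ring X)"
  unfolding carrier_poly_ring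
proof
  fix m assume "m \<in> Poly_Mapping.keys (p * q)"
  then obtain a b where "m = a + b" "a \<in> Poly_Mapping.keys p" "b \<in> Poly_Mapping.keys q"
    using Poly_Mapping.keys_mult[of p q] by blast
  then show "set_mset m \<subseteq> X" using assms unfolding carrier_poly_ring by auto
qed

lemma carrier_poly_ring_single:
  "set_mset m \<subseteq> X \<Longrightarrow> Poly_Mapping.single m c \<in> carrier (poly_ring X)"
  unfolding carrier_poly_ring by simp

lemma carrier_poly_ring_0: "0 \<in> carrier (poly_ring X)"
  unfolding carrier_poly_ring by simp

lemma carrier_poly_ring_1: "1 \<in> carrier (poly_ring X)"
  unfolding carrier_poly_ring by simp

lemma ring_poly_ring: "ring (poly_ring X :: ('x, 'k::field) mpoly ring)"
proof (rule ringI)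
  let ?R = "poly_ring X :: ('x, 'k) mpoly ring"
  show "abelian_group ?R"
  proof (rule abelian_groupI)
    fix x :: "('x, 'k) mpoly" assume "x \<in> carrier ?R"
    then show "\<exists>y \<in> carrier ?R. y \<oplus>\<^bsub>?R\<^esub> x = \<zero>\<^bsub>?R\<^esub>"
      by (intro bexI[of _ "- x"]) (simp_all add: carrier_poly_ring_uminus)
  qed (simp_all add: carrier_poly_ring_add carrier_poly_ring_0 add.assoc add.commute)
  show "monoid ?R"
    by (rule monoidI) (simp_all add: carrier_poly_ring_mult carrier_poly_ring_1 mult.assoc)
qed (simp_all add: algebra_simps)

lemma ideal_poly_ringI:
  fixes I :: "('x, 'k::field) mpoly set"
  assumes "I \<subseteq> carrier (poly_ring X)" "0 \<in> I"
    and add: "\<And>p q. p \<in> I \<Longrightarrow> q \<in> I \<Longrightarrow> p + q \<in> I"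
    and mult: "\<And>p q. p \<in> I \<Longrightarrow> q \<in> carrier (poly_ring X) \<Longrightarrow> q * p \<in> I"
  shows "ideal I (poly_ring X)"
proof (rule idealI[OF ring_poly_ring])
  let ?R = "poly_ring X :: ('x, 'k) mpoly ring"
  interpret ring ?R by (rule ring_poly_ring)
  have um: "- p \<in> I" if "p \<in> I" for p
    using mult[OF that, of "- 1"] by (simp add: carrier_poly_ring_uminus carrier_poly_ring_1)
  have inv: "\<ominus>\<^bsub>?R\<^esub> p = - p" if "p \<in> carrier ?R" for p
    using that by (intro minus_equality) (simp_all add: carrier_poly_ring_uminus)
  show "subgroup I (add_monoid ?R)"
  proof (rule add.subgroupI)
    show "\<ominus>\<^bsub>?R\<^esub> p \<in> I" if "p \<in> I" for p
      using inv um that assms(1) by auto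
  qed (use assms in auto)
  show "p \<otimes>\<^bsub>?R\<^esub> q \<in> I" if "p \<in> I" "q \<in> carrier ?R" for p q
    using mult[OF that] by (simp add: mult.commute)
qed (use mult in auto)

context
  fixes I :: "('x, 'k::field) mpoly set" and X
  assumes I: "ideal I (poly_ring X)"
begin

lemma ideal_poly_ring_0: "0 \<in> I"
  using additive_subgroup.zero_closed[OF ideal.axioms(1)[OF I]] by simp

lemma ideal_poly_ring_add: "p \<in> I \<Longrightarrow> q \<in> I \<Longrightarrow> p + q \<in> I"
  using additive_subgroup.a_closed[OF ideal.axioms(1)[OF I]] by simp

lemma ideal_poly_ring_mult: "p \<in> I \<Longrightarrow> q \<in> carrier (poly_ring X) \<Longrightarrow> q * p \<in> I"
  using ideal.I_l_closed[OF I] by simp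

lemma ideal_poly_ring_uminus: "p \<in> I \<Longrightarrow> - p \<in> I"
  using ideal_poly_ring_mult[of p "- 1"] by (simp add: carrier_poly_ring_uminus carrier_poly_ring_1)

lemma ideal_poly_ring_sum: "(\<And>i. i \<in> A \<Longrightarrow> f i \<in> I) \<Longrightarrow> sum f A \<in> I"
  by (induction A rule: infinite_finite_induct) (auto intro: ideal_poly_ring_0 ideal_poly_ring_add)

end

lemma ideal_Idl_poly_ring:
  "F \<subseteq> carrier (poly_ring X) \<Longrightarrow> ideal (Idl\<^bsub>poly_ring X\<^esub> F) (poly_ring X)"
  by (rule ring.genideal_ideal[OF ring_poly_ring])

lemma Idl_poly_ring_self:
  "F \<subseteq> carrier (poly_ring X) \<Longrightarrow> F \<subseteq> Idl\<^bsub>poly_ring X\<^esub> F"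
  by (rule ring.genideal_self[OF ring_poly_ring])

lemma Idl_poly_ring_minimal:
  "ideal I (poly_ring X) \<Longrightarrow> F \<subseteq> I \<Longrightarrow> Idl\<^bsub>poly_ring X\<^esub> F \<subseteq> I"
  by (rule ring.genideal_minimal[OF ring_poly_ring])

section \<open>Sums of coefficients over sets of monomials\<close>

lemma sum_single_lookup:
  "(\<Sum>m \<in> Poly_Mapping.keys f. Poly_Mapping.single m (Poly_Mapping.lookup f m)) = f"
proof (rule poly_mapping_eqI)
  fix k
  show "Poly_Mapping.lookup (\<Sum>m \<in> Poly_Mapping.keys f.
          Poly_Mapping.single m (Poly_Mapping.lookup f m)) k = Poly_Mapping.lookup f k"
    by (cases "k \<in> Poly_Mapping.keys f")
      (auto simp: lookup_sum lookup_single when_def in_keys_iff sum.delta')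
qed

text \<open>A linear functional with two uses: for \<open>C\<close> a fibre of the monomial map it
  is one coefficient of the image polynomial, and for \<open>C\<close> a union of classes of
  \<open>conn\<close> it is an obstruction to membership in the ideal.\<close>

definition coeff_sum :: "'x monomial set \<Rightarrow> ('x, 'k::field) mpoly \<Rightarrow> 'k" where
  "coeff_sum C f = (\<Sum>m \<in> Poly_Mapping.keys f. if m \<in> C then Poly_Mapping.lookup f m else 0)"

lemma coeff_sum_superset:
  assumes "finite K" "Poly_Mapping.keys f \<subseteq> K"
  shows "coeff_sum C f = (\<Sum>m \<in> K. if m \<in> C then Poly_Mapping.lookup f m else 0)"
  unfolding coeff_sum_def
  by (rule sum.mono_neutral_left) (use assms in \<open>auto simp: in_keys_iff\<close>)

lemma coeff_sum_add:
  fixes f g :: "('x, 'k::field) mpoly"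
  shows "coeff_sum C (f + g) = coeff_sum C f + coeff_sum C g"
proof -
  let ?K = "Poly_Mapping.keys f \<union> Poly_Mapping.keys g"
  have K: "coeff_sum C h = (\<Sum>m \<in> ?K. if m \<in> C then Poly_Mapping.lookup h m else 0)"
    if "Poly_Mapping.keys h \<subseteq> ?K" for h :: "('x, 'k) mpoly"
    using that by (intro coeff_sum_superset) simp_all
  show ?thesis
    by (simp add: K Poly_Mapping.keys_add lookup_add flip: sum.distrib)
      (rule sum.cong, simp_all add: lookup_add)
qed

lemma coeff_sum_0 [simp]: "coeff_sum C 0 = 0"
  by (simp add: coeff_sum_def)

lemma coeff_sum_sum: "coeff_sum C (sum f A) = (\<Sum>i \<in> A. coeff_sum C (f i))"
  by (induction A rule: infinite_finite_induct) (auto simp: coeff_sum_add)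

lemma coeff_sum_single [simp]:
  "coeff_sum C (Poly_Mapping.single m c) = (if m \<in> C then c else 0)"
  by (simp add: coeff_sum_def)

lemma coeff_sum_monom_diff:
  "coeff_sum C (monom m - monom m' :: ('x, 'k::field) mpoly) = of_bool (m \<in> C) - of_bool (m' \<in> C)"
proof -
  have "monom m - monom m' = (Poly_Mapping.single m 1 + Poly_Mapping.single m' (- 1) :: ('x, 'k) mpoly)"
    by (simp add: monom_def single_uminus)
  then show ?thesis by (simp add: coeff_sum_add)
qed

lemma coeff_sum_single_mult:
  "coeff_sum C (Poly_Mapping.single p c * f) = c * coeff_sum {m. p + m \<in> C} f"
proof -
  have "Poly_Mapping.single p c * f =
      (\<Sum>m \<in> Poly_Mapping.keys f. Poly_Mapping.single (p + m) (c * Poly_Mapping.lookup f m))"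
    by (subst sum_single_lookup[of f, symmetric]) (simp add: sum_distrib_left mult_single)
  then show ?thesis
    by (simp add: coeff_sum_sum) (auto simp: coeff_sum_def sum_distrib_left intro!: sum.cong)
qed

text \<open>Multiplying by a term with monomial \<open>p\<close> replaces the functional of
  \<open>C\<close> by that of the preimage of \<open>C\<close> under translation by
  \<open>p\<close>. Closure under such preimages therefore makes the common zeros an ideal.\<close>

lemma ideal_coeff_sum:
  fixes X :: "'x set"
  assumes tr: "\<And>C p. C \<in> \<C> \<Longrightarrow> {m. p + m \<in> C} \<in> \<C>"
  shows "ideal {f \<in> carrier (poly_ring X). \<forall>C \<in> \<C>. coeff_sum C f = (0 :: 'k::field)} (poly_ring X)"
proof (rule ideal_poly_ringI, goal_cases)
  case (4 f q)
  have "coeff_sum C (q * f) = 0" if "C \<in> \<C>" for C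
  proof -
    have "q * f = (\<Sum>p \<in> Poly_Mapping.keys q. Poly_Mapping.single p (Poly_Mapping.lookup q p) * f)"
      by (subst sum_single_lookup[of q, symmetric]) (simp add: sum_distrib_right)
    then show ?thesis
      using 4 tr[OF that] by (auto simp: coeff_sum_sum coeff_sum_single_mult intro!: sum.neutral)
  qed
  then show ?case using 4 by (simp add: carrier_poly_ring_mult)
qed (auto simp: coeff_sum_add carrier_poly_ring_0 carrier_poly_ring_add)

text \<open>If all coefficient sums over the fibres of \<open>\<Phi>\<close> vanish, replacing each monomial by a chosen
  representative of its fibre turns the polynomial into \<open>0\<close>.\<close>

lemma mem_ideal_if_fibre_sums_0:
  fixes f :: "('x, 'k::field) mpoly" and \<Phi> :: "'x monomial \<Rightarrow> 'b"
  assumes I: "ideal I (poly_ring X)"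
    and fib: "\<And>t. coeff_sum {m. \<Phi> m = t} f = 0"
    and bin: "\<And>m m'. m \<in> Poly_Mapping.keys f \<Longrightarrow> m' \<in> Poly_Mapping.keys f \<Longrightarrow> \<Phi> m = \<Phi> m' \<Longrightarrow>
      monom m - monom m' \<in> I"
  shows "f \<in> I"
proof -
  let ?K = "Poly_Mapping.keys f"
  define rep where "rep t = (SOME m. m \<in> ?K \<and> \<Phi> m = t)" for t
  have rep: "rep (\<Phi> m) \<in> ?K \<and> \<Phi> (rep (\<Phi> m)) = \<Phi> m" if "m \<in> ?K" for m
    unfolding rep_def by (rule someI[of _ m]) (use that in simp)
  have "(\<Sum>m \<in> ?K. Poly_Mapping.single (rep (\<Phi> m)) (Poly_Mapping.lookup f m)) = 0"
  proof -
    have "(\<Sum>m \<in> ?K. Poly_Mapping.single (rep (\<Phi> m)) (Poly_Mapping.lookup f m)) =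
      (\<Sum>t \<in> \<Phi> ` ?K. \<Sum>m \<in> {m \<in> ?K. \<Phi> m = t}. Poly_Mapping.single (rep (\<Phi> m)) (Poly_Mapping.lookup f m))"
      by (rule sum.image_gen) simp
    also have "\<dots> = (\<Sum>t \<in> \<Phi> ` ?K. Poly_Mapping.single (rep t) (coeff_sum {m. \<Phi> m = t} f))"
    proof (rule sum.cong[OF refl])
      fix t
      have "(\<Sum>m \<in> {m \<in> ?K. \<Phi> m = t}. Poly_Mapping.single (rep (\<Phi> m)) (Poly_Mapping.lookup f m)) =
        (\<Sum>m \<in> {m \<in> ?K. \<Phi> m = t}. Poly_Mapping.single (rep t) (Poly_Mapping.lookup f m))"
        by (rule sum.cong) auto
      also have "\<dots> = Poly_Mapping.single (rep t) (\<Sum>m \<in> {m \<in> ?K. \<Phi> m = t}. Poly_Mapping.lookup f m)"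
      proof -
        have "(\<Sum>m \<in> A. Poly_Mapping.single r (g m)) = Poly_Mapping.single r (sum g A)"
          if "finite A" for A and g :: "'x monomial \<Rightarrow> 'k" and r :: "'x monomial"
          using that by induction (auto simp: single_add)
        then show ?thesis by simp
      qed
      also have "(\<Sum>m \<in> {m \<in> ?K. \<Phi> m = t}. Poly_Mapping.lookup f m) = coeff_sum {m. \<Phi> m = t} f"
        unfolding coeff_sum_def by (simp add: sum.inter_filter)
      finally show "(\<Sum>m \<in> {m \<in> ?K. \<Phi> m = t}. Poly_Mapping.single (rep (\<Phi> m)) (Poly_Mapping.lookup f m)) =
        Poly_Mapping.single (rep t) (coeff_sum {m. \<Phi> m = t} f)" .
    qed
    also have "\<dots> = 0" by (simp add: fib)
    finally show ?thesis .
  qed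
  then have "f = (\<Sum>m \<in> ?K. Poly_Mapping.single m (Poly_Mapping.lookup f m)) -
      (\<Sum>m \<in> ?K. Poly_Mapping.single (rep (\<Phi> m)) (Poly_Mapping.lookup f m))"
    by (simp add: sum_single_lookup)
  also have "\<dots> = (\<Sum>m \<in> ?K. Poly_Mapping.single {#} (Poly_Mapping.lookup f m) *
      (monom m - monom (rep (\<Phi> m))))"
    by (simp add: monom_def sum_subtractf right_diff_distrib mult_single)
  also have "\<dots> \<in> I"
    by (intro ideal_poly_ring_sum[OF I] ideal_poly_ring_mult[OF I] bin)
      (use rep in \<open>auto intro: carrier_poly_ring_single\<close>)
  finally show ?thesis .
qed

section \<open>Moves between monomials\<close>

definition binomials :: "('x monomial \<times> 'x monomial) set \<Rightarrow> ('x, 'k::field) mpoly set" where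
  "binomials B = (\<lambda>(m, m'). monom m - monom m') ` B"

definition moves :: "('x monomial \<times> 'x monomial) set \<Rightarrow> ('x monomial \<times> 'x monomial) set" where
  "moves B = {(p + n, p + n') | p n n'. (n, n') \<in> B \<or> (n', n) \<in> B}"

text \<open>This is the congruence on the monoid of monomials that \<open>B\<close>
  generates.\<close>

definition conn :: "('x monomial \<times> 'x monomial) set \<Rightarrow> ('x monomial \<times> 'x monomial) set" where
  "conn B = (moves B)\<^sup>*"

lemma movesI: "(n, n') \<in> B \<or> (n', n) \<in> B \<Longrightarrow> (p + n, p + n') \<in> moves B"
  unfolding moves_def by blast

lemma sym_moves: "sym (moves B)"
  unfolding moves_def by (rule symI) blast

lemma conn_sym: "(m, m') \<in> conn B \<Longrightarrow> (m', m) \<in> conn B"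
  unfolding conn_def using sym_rtrancl[OF sym_moves] by (rule symD)

lemma conn_refl [simp]: "(m, m) \<in> conn B"
  by (simp add: conn_def)

lemma conn_trans: "(m, m') \<in> conn B \<Longrightarrow> (m', m'') \<in> conn B \<Longrightarrow> (m, m'') \<in> conn B"
  unfolding conn_def by (rule rtrancl_trans)

lemma conn_base: "(n, n') \<in> B \<Longrightarrow> (n, n') \<in> conn B"
  unfolding conn_def by (rule r_into_rtrancl) (auto intro: movesI[where p = "{#}", simplified])

lemma conn_add: "(m, m') \<in> conn B \<Longrightarrow> (q + m, q + m') \<in> conn B"
  unfolding conn_def
proof (induction rule: rtrancl_induct)
  case (step y z)
  from step(2) have "(q + y, q + z) \<in> moves B"
    unfolding moves_def by (force simp: add.assoc[symmetric])
  with step(3) show ?case by simp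
qed simp

lemma conn_subset:
  assumes "B \<subseteq> conn B'"
  shows "conn B \<subseteq> conn B'"
proof -
  have "moves B \<subseteq> conn B'"
    using assms unfolding moves_def by (auto intro: conn_add conn_sym)
  then show ?thesis
    unfolding conn_def by (rule rtrancl_subset_rtrancl)
qed

lemma conn_mono: "B \<subseteq> B' \<Longrightarrow> conn B \<subseteq> conn B'"
  by (rule conn_subset) (auto intro: conn_base)

text \<open>The binomial telescopes along the walk, and each step contributes a monomial times a
  generator up to sign. The claim about the variables of \<open>m'\<close> is carried along because
  that monomial has to lie in the ring.\<close>

lemma conn_imp_binomial_in_ideal:
  assumes I: "ideal I (poly_ring X)" and B: "binomials B \<subseteq> I"
    and B': "\<And>n n'. (n, n') \<in> B \<Longrightarrow> set_mset n \<subseteq> X \<and> set_mset n' \<subseteq> X"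
    and c: "(m, m') \<in> conn B" and m: "set_mset m \<subseteq> X"
  shows "set_mset m' \<subseteq> X \<and> (monom m - monom m' :: ('x, 'k::field) mpoly) \<in> I"
  using c unfolding conn_def
proof (induction rule: rtrancl_induct)
  case base
  then show ?case using m by (simp add: ideal_poly_ring_0[OF I])
next
  case (step y z)
  then obtain p n n' where pn: "y = p + n" "z = p + n'" "(n, n') \<in> B \<or> (n', n) \<in> B"
    unfolding moves_def by blast
  have "(monom n - monom n' :: ('x, 'k) mpoly) \<in> I"
    using pn(3) B ideal_poly_ring_uminus[OF I, of "monom n' - monom n"]
    unfolding binomials_def by force
  then have "Poly_Mapping.single p 1 * (monom n - monom n' :: ('x, 'k) mpoly) \<in> I"
    using step pn by (intro ideal_poly_ring_mult[OF I] carrier_poly_ring_single) auto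
  then have "(monom y - monom z :: ('x, 'k) mpoly) \<in> I"
    by (simp add: pn monom_def right_diff_distrib mult_single)
  then have "(monom m - monom y) + (monom y - monom z :: ('x, 'k) mpoly) \<in> I"
    using step by (intro ideal_poly_ring_add[OF I]) auto
  then show ?case using step pn B' by auto
qed

text \<open>The functional of the class of \<open>m\<close> vanishes on all generators and hence on
  the ideal, while on the binomial it takes the value 1 unless \<open>m'\<close> is in the same
  class.\<close>

lemma binomial_in_Idl_imp_conn:
  fixes B :: "('x monomial \<times> 'x monomial) set"
  assumes B: "(binomials B :: ('x, 'k::field) mpoly set) \<subseteq> carrier (poly_ring X)"
    and m: "(monom m - monom m' :: ('x, 'k) mpoly) \<in> Idl\<^bsub>poly_ring X\<^esub> (binomials B)"
  shows "(m, m') \<in> conn B"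
proof -
  \<comment> \<open>All unions of classes are taken, because the preimage of a single class under a
    translation can consist of several classes or of none.\<close>
  define \<C> where "\<C> = {C. \<forall>n n'. (n, n') \<in> conn B \<longrightarrow> (n \<in> C \<longleftrightarrow> n' \<in> C)}"
  let ?J = "{f \<in> carrier (poly_ring X). \<forall>C \<in> \<C>. coeff_sum C f = (0 :: 'k)}"
  have J: "ideal ?J (poly_ring X)"
    by (rule ideal_coeff_sum) (auto simp: \<C>_def dest: conn_add)
  have "binomials B \<subseteq> ?J"
  proof
    fix f :: "('x, 'k) mpoly" assume f: "f \<in> (binomials B :: ('x, 'k) mpoly set)"
    then obtain n n' where "(n, n') \<in> B" "f = monom n - monom n'"
      unfolding binomials_def by auto
    then show "f \<in> ?J"
      using f B conn_base[of n n' B] by (auto simp: \<C>_def coeff_sum_monom_diff)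
  qed
  from Idl_poly_ring_minimal[OF J this] m have "\<forall>C \<in> \<C>. coeff_sum C (monom m - monom m') = (0 :: 'k)"
    by auto
  moreover have "{n. (m, n) \<in> conn B} \<in> \<C>"
    by (auto simp: \<C>_def dest: conn_trans conn_sym)
  ultimately have "coeff_sum {n. (m, n) \<in> conn B} (monom m - monom m') = (0 :: 'k)" by blast
  then show ?thesis by (auto simp: coeff_sum_monom_diff split: if_splits)
qed

section \<open>The fibres of the monomial map\<close>

text \<open>The fibre is described by the degree and the exponents of the variables
  \<open>S e\<close>; the exponent of \<open>T e\<close> is the degree minus that of
  \<open>S e\<close>.\<close>

definition fibre_pairs :: "'a graph \<Rightarrow> ('a cut monomial \<times> 'a cut monomial) set" where
  "fibre_pairs G = {(m, m'). m \<in> cut_monomials G \<and> m' \<in> cut_monomials G \<and> size m = size m' \<and>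
     (\<forall>e \<in> edges G. size (filter_mset (in_cut e) m) = size (filter_mset (in_cut e) m'))}"

definition edge_monomial :: "'a graph \<Rightarrow> 'a cut \<Rightarrow> 'a st_var monomial" where
  "edge_monomial G c = image_mset S (mset_set {e \<in> edges G. in_cut e c}) +
     image_mset T (mset_set {e \<in> edges G. \<not> in_cut e c})"

definition cut_image :: "'a graph \<Rightarrow> 'a cut monomial \<Rightarrow> 'a st_var monomial" where
  "cut_image G m = \<Sum>\<^sub># (image_mset (edge_monomial G) m)"

lemma fibre_pairs_refl: "m \<in> cut_monomials G \<Longrightarrow> (m, m) \<in> fibre_pairs G"
  by (simp add: fibre_pairs_def)

lemma fibre_pairs_sym: "(m, m') \<in> fibre_pairs G \<Longrightarrow> (m', m) \<in> fibre_pairs G"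
  by (auto simp: fibre_pairs_def)

lemma fibre_pairs_trans:
  "(m, m') \<in> fibre_pairs G \<Longrightarrow> (m', m'') \<in> fibre_pairs G \<Longrightarrow> (m, m'') \<in> fibre_pairs G"
  by (auto simp: fibre_pairs_def)

text \<open>Degrees and edge counts are additive and cancellative. One direction translates moves;
  the other strips a smaller pair off a given one in the Graver argument.\<close>

lemma fibre_pairs_add_iff:
  assumes "(n, n') \<in> fibre_pairs G"
  shows "(p + n, p' + n') \<in> fibre_pairs G \<longleftrightarrow> (p, p') \<in> fibre_pairs G"
  using assms by (auto simp: fibre_pairs_def cut_monomials_def)

lemma fibre_pairs_size: "(m, m') \<in> fibre_pairs G \<Longrightarrow> size m = size m'"
  by (simp add: fibre_pairs_def)

lemma conn_fibre_pairs:
  assumes "B \<subseteq> fibre_pairs G" "(m, m') \<in> conn B" "m \<in> cut_monomials G"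
  shows "(m, m') \<in> fibre_pairs G"
  using assms(2) unfolding conn_def
proof (induction rule: rtrancl_induct)
  case base
  then show ?case using assms(3) by (rule fibre_pairs_refl)
next
  case (step y z)
  then obtain p n n' where pn: "y = p + n" "z = p + n'" "(n, n') \<in> B \<or> (n', n) \<in> B"
    unfolding moves_def by blast
  then have n: "(n, n') \<in> fibre_pairs G" using assms(1) fibre_pairs_sym by blast
  have "p \<in> cut_monomials G" using step(3) pn by (simp add: fibre_pairs_def cut_monomials_def)
  then have "(y, z) \<in> fibre_pairs G" using pn fibre_pairs_add_iff[OF n] fibre_pairs_refl by blast
  with step(3) show ?case by (rule fibre_pairs_trans)
qed

lemma count_cut_image:
  assumes "finite (edges G)"
  shows "count (cut_image G m) (S e) = (if e \<in> edges G then size (filter_mset (in_cut e) m) else 0)"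
    and "count (cut_image G m) (T e) =
      (if e \<in> edges G then size m - size (filter_mset (in_cut e) m) else 0)"
proof -
  have inj: "count (image_mset S M) (S e) = count M e" "count (image_mset T M) (T e) = count M e"
    for M :: "'a set multiset" by (induction M) auto
  have z: "count (image_mset T M) (S e) = 0" "count (image_mset S M) (T e) = 0" for M
    by (auto simp: count_eq_zero_iff)
  have le: "size (filter_mset P m) \<le> size m" for P and m :: "'a cut multiset"
    by (rule size_filter_mset_lesseq)
  show "count (cut_image G m) (S e) = (if e \<in> edges G then size (filter_mset (in_cut e) m) else 0)"
    by (induction m) (auto simp: cut_image_def edge_monomial_def inj z count_mset_set' assms)
  show "count (cut_image G m) (T e) =
      (if e \<in> edges G then size m - size (filter_mset (in_cut e) m) else 0)"
    by (induction m) (auto simp: cut_image_def edge_monomial_def inj z count_mset_set' assms Suc_diff_le le)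
qed

text \<open>Any edge \<open>e\<close> recovers the degree as the sum of the exponents of
  \<open>S e\<close> and \<open>T e\<close>. In a graph without edges every monomial has the empty
  image, and the degree is lost.\<close>

lemma cut_image_eq_iff:
  assumes "finite (edges G)" "edges G \<noteq> {}"
  shows "cut_image G m = cut_image G m' \<longleftrightarrow> size m = size m' \<and>
    (\<forall>e \<in> edges G. size (filter_mset (in_cut e) m) = size (filter_mset (in_cut e) m'))"
    (is "?l \<longleftrightarrow> ?r")
proof
  assume l: ?l
  have e: "size (filter_mset (in_cut e) m) = size (filter_mset (in_cut e) m')" "size m = size m'"
    if "e \<in> edges G" for e
  proof -
    show s: "size (filter_mset (in_cut e) m) = size (filter_mset (in_cut e) m')"
      using count_cut_image(1)[OF assms(1), of m e] count_cut_image(1)[OF assms(1), of m' e] l that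
      by simp
    show "size m = size m'"
    proof -
      have "size m - size (filter_mset (in_cut e) m) = size m' - size (filter_mset (in_cut e) m')"
        using count_cut_image(2)[OF assms(1), of m e] count_cut_image(2)[OF assms(1), of m' e] l that
        by simp
      then show ?thesis
        using s size_filter_mset_lesseq[of "in_cut e" m] size_filter_mset_lesseq[of "in_cut e" m']
        by linarith
    qed
  qed
  with assms(2) show ?r by blast
next
  assume r: ?r
  show ?l
  proof (rule multiset_eqI)
    fix x
    show "count (cut_image G m) x = count (cut_image G m') x"
      by (cases x) (use r in \<open>simp_all add: count_cut_image assms(1)\<close>)
  qed
qed

lemma prod_var:
  "(\<Prod>e \<in> A. var (f e)) = (monom (image_mset f (mset_set A)) :: ('x, 'k::field) mpoly)"
proof (induction A rule: infinite_finite_induct)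
  case (insert x F)
  then show ?case by (simp add: var_def monom_def mult_single)
qed (simp_all add: monom_def flip: zero_multiset_def)

text \<open>Each variable is sent to a single monomial, so the homomorphism is the linear extension
  of a map between monomials.\<close>

lemma cut_hom_eq:
  "cut_hom G p = (\<Sum>m \<in> Poly_Mapping.keys p.
     Poly_Mapping.single (cut_image G m) (Poly_Mapping.lookup p m) :: ('a st_var, 'k::field) mpoly)"
proof -
  have "prod_mset (image_mset (\<lambda>c. monom (edge_monomial G c)) m) =
      (monom (cut_image G m) :: ('a st_var, 'k) mpoly)" for m
    by (induction m) (simp_all add: cut_image_def monom_def mult_single flip: zero_multiset_def)
  moreover have "(\<Prod>e \<in> {e \<in> edges G. in_cut e c}. var (S e)) * (\<Prod>e \<in> {e \<in> edges G. \<not> in_cut e c}. var (T e)) =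
      (monom (edge_monomial G c) :: ('a st_var, 'k) mpoly)" for c
    by (simp add: prod_var edge_monomial_def) (simp add: monom_def mult_single)
  ultimately show ?thesis
    by (simp add: cut_hom_def poly_hom_def) (simp add: monom_def mult_single)
qed

text \<open>The coefficient of \<open>t\<close> in the image is the sum of the coefficients over the
  fibre above \<open>t\<close>.\<close>

lemma mem_cut_ideal:
  "f \<in> cut_ideal G \<longleftrightarrow> f \<in> carrier (poly_ring (cuts G)) \<and>
     (\<forall>t. coeff_sum {m. cut_image G m = t} f = 0)"
proof -
  have "Poly_Mapping.lookup (cut_hom G f) t = coeff_sum {m. cut_image G m = t} f" for t
    by (simp add: cut_hom_eq lookup_sum coeff_sum_def lookup_single when_def)
  then show ?thesis
    by (auto simp: cut_ideal_def a_kernel_def' poly_mapping_eq_iff fun_eq_iff)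
qed

lemma ideal_cut_ideal: "ideal (cut_ideal G :: ('a cut, 'k::field) mpoly set) (poly_ring (cuts G))"
proof -
  \<comment> \<open>The preimage of a fibre under translation by \<open>p\<close> is again a fibre
    if the image of \<open>p\<close> divides the target monomial, and empty otherwise; hence the
    extra empty set.\<close>
  define \<C> where "\<C> = insert {} (range (\<lambda>t. {m. cut_image G m = t}))"
  have "{m. p + m \<in> C} \<in> \<C>" if "C \<in> \<C>" for C p
  proof (cases "\<exists>t. C = {m. cut_image G m = cut_image G p + t}")
    case True
    then show ?thesis by (auto simp: \<C>_def cut_image_def)
  next
    case False
    then have "{m. p + m \<in> C} = {}" using that by (auto simp: \<C>_def cut_image_def)
    then show ?thesis by (simp add: \<C>_def)
  qed
  then have "ideal {f \<in> carrier (poly_ring (cuts G)). \<forall>C \<in> \<C>. coeff_sum C f = (0 :: 'k)}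
      (poly_ring (cuts G))"
    by (rule ideal_coeff_sum)
  also have "{f \<in> carrier (poly_ring (cuts G)). \<forall>C \<in> \<C>. coeff_sum C f = (0 :: 'k)} = cut_ideal G"
    by (auto simp: mem_cut_ideal \<C>_def coeff_sum_def)
  finally show ?thesis .
qed

section \<open>Binomials in the cut ideal\<close>

lemma cut_ideal_carrier: "cut_ideal G \<subseteq> carrier (poly_ring (cuts G))"
  by (auto simp: mem_cut_ideal)

lemma keys_monom_diff:
  assumes "m \<noteq> m'"
  shows "Poly_Mapping.keys (monom m - monom m' :: ('x, 'k::field) mpoly) = {m, m'}"
  using assms by (auto simp: in_keys_iff lookup_minus monom_def lookup_single when_def split: if_splits)

lemma deg_monom_diff:
  assumes "m \<noteq> m'"
  shows "deg (monom m - monom m' :: ('x, 'k::field) mpoly) = max (size m) (size m')"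
  by (simp add: deg_def keys_monom_diff[OF assms])

lemma deg_monom_diff_le:
  assumes "size m \<le> d" "size m' \<le> d"
  shows "deg (monom m - monom m' :: ('x, 'k::field) mpoly) \<le> d"
  using assms by (cases "m = m'") (simp_all add: deg_monom_diff, simp add: deg_def)

lemma size_le_deg: "m \<in> Poly_Mapping.keys p \<Longrightarrow> size m \<le> deg p"
  by (simp add: deg_def)

context
  fixes G :: "'a graph"
  assumes fin: "finite (edges G)" and ne: "edges G \<noteq> {}"
begin

text \<open>The disjunct \<open>m = m'\<close> accounts for the zero polynomial, which is in the
  ideal even if \<open>m\<close> involves variables that are not cuts of \<open>G\<close>.\<close>

lemma monom_diff_mem_cut_ideal:
  "monom m - monom m' \<in> (cut_ideal G :: ('a cut, 'k::field) mpoly set) \<longleftrightarrow>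
     m = m' \<or> (m, m') \<in> fibre_pairs G"
proof (cases "m = m'")
  case True
  then show ?thesis using ideal_poly_ring_0[OF ideal_cut_ideal] by simp
next
  case False
  have "(\<forall>t. coeff_sum {m. cut_image G m = t} (monom m - monom m') = (0 :: 'k)) \<longleftrightarrow>
      cut_image G m = cut_image G m'"
    by (auto simp: coeff_sum_monom_diff)
  moreover have "monom m - monom m' \<in> (carrier (poly_ring (cuts G)) :: ('a cut, 'k) mpoly set) \<longleftrightarrow>
      m \<in> cut_monomials G \<and> m' \<in> cut_monomials G"
    by (simp add: carrier_poly_ring keys_monom_diff[OF False] cut_monomials_def)
  ultimately show ?thesis
    using False by (simp add: mem_cut_ideal cut_image_eq_iff[OF fin ne] fibre_pairs_def)
qed

lemma binomials_subset_cut_ideal: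
  "B \<subseteq> fibre_pairs G \<Longrightarrow> (binomials B :: ('a cut, 'k::field) mpoly set) \<subseteq> cut_ideal G"
  by (auto simp: binomials_def monom_diff_mem_cut_ideal)

text \<open>An element of the kernel has vanishing fibre sums and is thus a combination of binomials
  inside fibres, so only such binomials have to be tested; for them ideal membership is a question
  of walks.\<close>

lemma binomials_generate_iff:
  assumes B: "B \<subseteq> fibre_pairs G"
  shows "generates_cut_ideal (binomials B :: ('a cut, 'k::field) mpoly set) G \<longleftrightarrow>
    fibre_pairs G \<subseteq> conn B"
proof
  have sub: "(binomials B :: ('a cut, 'k) mpoly set) \<subseteq> cut_ideal G"
    by (rule binomials_subset_cut_ideal[OF B])
  then have car: "(binomials B :: ('a cut, 'k) mpoly set) \<subseteq> carrier (poly_ring (cuts G))"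
    using cut_ideal_carrier by blast
  note I = ideal_Idl_poly_ring[OF car]
  {
    assume gen: "generates_cut_ideal (binomials B :: ('a cut, 'k) mpoly set) G"
    show "fibre_pairs G \<subseteq> conn B"
    proof clarify
      fix m m' assume "(m, m') \<in> fibre_pairs G"
      then have "monom m - monom m' \<in> (cut_ideal G :: ('a cut, 'k) mpoly set)"
        by (simp add: monom_diff_mem_cut_ideal)
      with gen show "(m, m') \<in> conn B"
        using binomial_in_Idl_imp_conn[OF car] unfolding generates_cut_ideal_def by blast
    qed
  next
    assume fc: "fibre_pairs G \<subseteq> conn B"
    have "f \<in> Idl\<^bsub>poly_ring (cuts G)\<^esub> (binomials B)" if f: "f \<in> cut_ideal G" for f :: "('a cut, 'k) mpoly"
    proof (rule mem_ideal_if_fibre_sums_0[OF I, where \<Phi> = "cut_image G"])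
      show "coeff_sum {m. cut_image G m = t} f = 0" for t
        using f by (simp add: mem_cut_ideal)
      fix m m' assume m: "m \<in> Poly_Mapping.keys f" "m' \<in> Poly_Mapping.keys f" "cut_image G m = cut_image G m'"
      then have "m \<in> cut_monomials G" "m' \<in> cut_monomials G"
        using f by (auto simp: mem_cut_ideal carrier_poly_ring cut_monomials_def)
      with m have "(m, m') \<in> fibre_pairs G" by (simp add: fibre_pairs_def cut_image_eq_iff[OF fin ne])
      then show "(monom m - monom m' :: ('a cut, 'k) mpoly) \<in> Idl\<^bsub>poly_ring (cuts G)\<^esub> (binomials B)"
      proof (intro conjunct2[OF conn_imp_binomial_in_ideal[OF I Idl_poly_ring_self[OF car], of m m']])
        show "set_mset n \<subseteq> cuts G \<and> set_mset n' \<subseteq> cuts G" if "(n, n') \<in> B" for n n'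
          using subsetD[OF B that] by (simp add: fibre_pairs_def cut_monomials_def)
        show "(m, m') \<in> conn B"
          using fc \<open>(m, m') \<in> fibre_pairs G\<close> by (rule subsetD)
        show "set_mset m \<subseteq> cuts G"
          using \<open>m \<in> cut_monomials G\<close> by (simp add: cut_monomials_def)
      qed
    qed
    with Idl_poly_ring_minimal[OF ideal_cut_ideal sub] car
    show "generates_cut_ideal (binomials B :: ('a cut, 'k) mpoly set) G"
      unfolding generates_cut_ideal_def by blast
  }
qed

text \<open>A polynomial of degree at most \<open>d\<close> in the ideal is a combination of binomials of degree at
  most \<open>d\<close>.\<close>

lemma degree_bounded_generators_imp_conn:
  fixes F :: "('a cut, 'k::field) mpoly set"
  assumes gen: "generates_cut_ideal F G" and d: "\<And>f. f \<in> F \<Longrightarrow> deg f \<le> d"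
  shows "fibre_pairs G \<subseteq> conn {(m, m') \<in> fibre_pairs G. size m \<le> d}" (is "_ \<subseteq> conn ?B")
proof -
  have B: "?B \<subseteq> fibre_pairs G" by blast
  have sub: "(binomials ?B :: ('a cut, 'k) mpoly set) \<subseteq> cut_ideal G"
    by (rule binomials_subset_cut_ideal[OF B])
  then have car: "(binomials ?B :: ('a cut, 'k) mpoly set) \<subseteq> carrier (poly_ring (cuts G))"
    using cut_ideal_carrier by blast
  note I = ideal_Idl_poly_ring[OF car]
  have Fc: "F \<subseteq> carrier (poly_ring (cuts G))" and FI: "Idl\<^bsub>poly_ring (cuts G)\<^esub> F = cut_ideal G"
    using gen by (auto simp: generates_cut_ideal_def)
  have F: "F \<subseteq> cut_ideal G" using Idl_poly_ring_self[OF Fc] FI by simp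
  have "f \<in> Idl\<^bsub>poly_ring (cuts G)\<^esub> (binomials ?B)" if f: "f \<in> F" for f
  proof (rule mem_ideal_if_fibre_sums_0[OF I, where \<Phi> = "cut_image G"])
    show "coeff_sum {m. cut_image G m = t} f = 0" for t
      using f F by (auto simp: mem_cut_ideal)
    fix m m' assume m: "m \<in> Poly_Mapping.keys f" "m' \<in> Poly_Mapping.keys f" "cut_image G m = cut_image G m'"
    have "f \<in> carrier (poly_ring (cuts G))" using f Fc by blast
    with m have "m \<in> cut_monomials G" "m' \<in> cut_monomials G"
      unfolding carrier_poly_ring cut_monomials_def by blast+
    then have "(m, m') \<in> ?B"
      using m size_le_deg[OF m(1)] d[OF f] by (simp add: fibre_pairs_def cut_image_eq_iff[OF fin ne])
    then have "monom m - monom m' \<in> (binomials ?B :: ('a cut, 'k) mpoly set)"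
      unfolding binomials_def by (intro image_eqI[of _ _ "(m, m')"]) simp_all
    then show "(monom m - monom m' :: ('a cut, 'k) mpoly) \<in> Idl\<^bsub>poly_ring (cuts G)\<^esub> (binomials ?B)"
      by (rule subsetD[OF Idl_poly_ring_self[OF car]])
  qed
  then have "(cut_ideal G :: ('a cut, 'k) mpoly set) \<subseteq> Idl\<^bsub>poly_ring (cuts G)\<^esub> (binomials ?B)"
    using Idl_poly_ring_minimal[OF I, of F] FI by blast
  with Idl_poly_ring_minimal[OF ideal_cut_ideal sub] car
  have "generates_cut_ideal (binomials ?B :: ('a cut, 'k) mpoly set) G"
    unfolding generates_cut_ideal_def by blast
  then show ?thesis by (simp only: binomials_generate_iff[OF B])
qed

end

section \<open>Finite generation\<close>

text \<open>Coordinates are treated one at a time. Every sequence has a monotone subsequence, and a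
  weakly decreasing one in the naturals is constant from its minimum on. Passing to a further
  subsequence keeps the coordinates already treated monotone.\<close>

lemma dickson_subseq:
  fixes f :: "nat \<Rightarrow> 'b \<Rightarrow> nat"
  assumes "finite X"
  shows "\<exists>\<phi> :: nat \<Rightarrow> nat. strict_mono \<phi> \<and> (\<forall>x \<in> X. mono (\<lambda>i. f (\<phi> i) x))"
  using assms
proof (induction X)
  case empty
  then show ?case by (intro exI[of _ id]) (simp add: strict_mono_def)
next
  case (insert x X)
  then obtain \<phi> :: "nat \<Rightarrow> nat" where \<phi>: "strict_mono \<phi>" "\<forall>x \<in> X. mono (\<lambda>i. f (\<phi> i) x)" by blast
  have "\<exists>\<psi> :: nat \<Rightarrow> nat. strict_mono \<psi> \<and> mono (\<lambda>i. f (\<phi> (\<psi> i)) x)"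
  proof -
    define g where "g i = f (\<phi> i) x" for i
    obtain \<psi> where \<psi>: "strict_mono (\<psi> :: nat \<Rightarrow> nat)" "monoseq (\<lambda>i. g (\<psi> i))"
      using seq_monosub[of g] by blast
    from \<psi>(2) consider "mono (\<lambda>i. g (\<psi> i))" | "antimono (\<lambda>i. g (\<psi> i))"
      unfolding monoseq_def mono_def antimono_def by blast
    then show ?thesis
    proof cases
      case 1
      then show ?thesis using \<psi> unfolding g_def by blast
    next
      case 2
      obtain k where k: "\<And>i. g (\<psi> k) \<le> g (\<psi> i)"
        using ex_has_least_nat[of "\<lambda>_. True" undefined "\<lambda>i. g (\<psi> i)"] by auto
      have "g (\<psi> (k + i)) = g (\<psi> k)" for i
        using k[of "k + i"] antimonoD[OF 2, of k "k + i"] by simp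
      then show ?thesis
        using \<psi>(1) unfolding g_def
        by (intro exI[of _ "\<lambda>i. \<psi> (k + i)"]) (simp add: strict_mono_def mono_def)
    qed
  qed
  then obtain \<psi> :: "nat \<Rightarrow> nat" where \<psi>: "strict_mono \<psi>" "mono (\<lambda>i. f (\<phi> (\<psi> i)) x)" by blast
  have "mono (\<lambda>i. f (\<phi> (\<psi> i)) y)" if "y \<in> X" for y
    using \<phi>(2) that \<psi>(1) by (simp add: mono_def strict_mono_less_eq)
  with \<phi>(1) \<psi> show ?case
    by (intro exI[of _ "\<phi> \<circ> \<psi>"]) (simp add: strict_mono_def)
qed

text \<open>Dickson's lemma: a pair of monomials over \<open>X\<close> is a vector of naturals
  indexed by two copies of \<open>X\<close>, and an infinite family would contain two comparable
  members.\<close>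

lemma finite_antichain_multiset_pairs:
  fixes A :: "('x multiset \<times> 'x multiset) set"
  assumes X: "finite X" and A: "\<And>m m'. (m, m') \<in> A \<Longrightarrow> set_mset m \<subseteq> X \<and> set_mset m' \<subseteq> X"
    and anti: "\<And>m m' n n'. (m, m') \<in> A \<Longrightarrow> (n, n') \<in> A \<Longrightarrow> m \<subseteq># n \<Longrightarrow> m' \<subseteq># n' \<Longrightarrow> (m, m') = (n, n')"
  shows "finite A"
proof (rule ccontr)
  assume "infinite A"
  then obtain s :: "nat \<Rightarrow> 'x multiset \<times> 'x multiset" where s: "inj s" "range s \<subseteq> A"
    using infinite_countable_subset by blast
  obtain \<phi> :: "nat \<Rightarrow> nat" where \<phi>: "strict_mono \<phi>"
    "\<forall>x \<in> X <+> X. mono (\<lambda>i. case_sum (count (fst (s (\<phi> i)))) (count (snd (s (\<phi> i)))) x)"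
    using dickson_subseq[of "X <+> X" "\<lambda>i. case_sum (count (fst (s i))) (count (snd (s i)))"] X by auto
  have le: "count (fst (s (\<phi> 0))) x \<le> count (fst (s (\<phi> 1))) x"
    "count (snd (s (\<phi> 0))) x \<le> count (snd (s (\<phi> 1))) x" if "x \<in> X" for x
    using \<phi>(2)[rule_format, of "Inl x"] \<phi>(2)[rule_format, of "Inr x"] that
    by (auto simp: mono_def)
  have sA: "(fst (s i), snd (s i)) \<in> A" for i using s(2) by auto
  have "fst (s (\<phi> 0)) \<subseteq># fst (s (\<phi> 1))" "snd (s (\<phi> 0)) \<subseteq># snd (s (\<phi> 1))"
  proof -
    have "count (fst (s (\<phi> 0))) x = 0" "count (snd (s (\<phi> 0))) x = 0" if "x \<notin> X" for x
      using A[OF sA[of "\<phi> 0"]] that by (auto simp: count_eq_zero_iff)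
    with le show "fst (s (\<phi> 0)) \<subseteq># fst (s (\<phi> 1))" "snd (s (\<phi> 0)) \<subseteq># snd (s (\<phi> 1))"
      unfolding subseteq_mset_def by (metis le0)+
  qed
  from anti[OF sA sA this] have "s (\<phi> 0) = s (\<phi> 1)" by (simp add: prod_eq_iff)
  with s(1) have "\<phi> 0 = \<phi> 1" by (simp add: inj_def)
  with \<phi>(1) show False by (simp add: strict_mono_eq)
qed

lemma finite_cuts: "finite (verts G) \<Longrightarrow> finite (cuts G)"
  by (rule finite_subset[of _ "Pow (Pow (verts G))"]) (auto simp: cuts_def)

text \<open>The pairs that are minimal among the nonempty ones (a Graver basis) connect all fibres.\<close>

lemma fibre_pairs_conn_bounded:
  assumes "finite (verts G)"
  shows "\<exists>d. fibre_pairs G \<subseteq> conn {(m, m') \<in> fibre_pairs G. size m \<le> d}"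
proof -
  \<comment> \<open>The pair of empty monomials lies below every pair and is excluded from the
    comparison.\<close>
  define N where "N = {(m, m') \<in> fibre_pairs G. m \<noteq> {#} \<and>
    (\<forall>(a, a') \<in> fibre_pairs G. a \<noteq> {#} \<longrightarrow> a \<subseteq># m \<longrightarrow> a' \<subseteq># m' \<longrightarrow> (a, a') = (m, m'))}"
  have "finite N"
  proof (rule finite_antichain_multiset_pairs[OF finite_cuts[OF assms]])
    show "(m, m') = (n, n')" if "(m, m') \<in> N" "(n, n') \<in> N" "m \<subseteq># n" "m' \<subseteq># n'" for m m' n n'
      using that unfolding N_def by blast
  qed (auto simp: N_def fibre_pairs_def cut_monomials_def)
  then obtain d where d: "\<And>m m'. (m, m') \<in> N \<Longrightarrow> size m \<le> d"
    by (metis (no_types, lifting) Max_ge finite_imageI fst_conv imageI)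
  have "(m, m') \<in> conn {(m, m') \<in> fibre_pairs G. size m \<le> d}" if "(m, m') \<in> fibre_pairs G" for m m'
    using that
  proof (induction "size m" arbitrary: m m' rule: less_induct)
    case less
    consider "m = {#}" | "(m, m') \<in> N" | "m \<noteq> {#}" "(m, m') \<notin> N" by blast
    then show ?case
    proof cases
      case 1
      then show ?thesis using fibre_pairs_size[OF less.prems] by simp
    next
      case 2
      then show ?thesis using d less.prems by (intro conn_base) auto
    next
      case 3
      then obtain a a' where a: "(a, a') \<in> fibre_pairs G" "a \<noteq> {#}" "a \<subseteq># m" "a' \<subseteq># m'" "(a, a') \<noteq> (m, m')"
        using less.prems by (auto simp: N_def)
      \<comment> \<open>The pair splits into \<open>(a, a')\<close> and the remainder
        \<open>(b, b')\<close>, both of smaller degree; the walk passes through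
        \<open>b + a'\<close>.\<close>
      then obtain b b' where b: "m = b + a" "m' = b' + a'"
        by (metis mset_subset_eq_exists_conv union_commute)
      have bf: "(b, b') \<in> fibre_pairs G"
        using less.prems b fibre_pairs_add_iff[OF a(1)] by blast
      have "b \<noteq> {#}" using a(5) b fibre_pairs_size[OF bf] by auto
      then have "size a < size m" "size b < size m" using a(2) b by (auto simp: nonempty_has_size)
      from less.hyps[OF this(1) a(1)] less.hyps[OF this(2) bf]
      have "(b + a, b + a') \<in> conn {(m, m') \<in> fibre_pairs G. size m \<le> d}"
        "(a' + b, a' + b') \<in> conn {(m, m') \<in> fibre_pairs G. size m \<le> d}"
        by (simp_all add: conn_add)
      then show ?thesis unfolding b by (simp add: add.commute[of a'] conn_trans)
    qed
  qed
  then show ?thesis by (intro exI[of _ d] subrelI)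
qed

text \<open>\<open>mu\<close> is a \<open>LEAST\<close>, which carries no information until some
  degree bound is known to work; the Graver bound provides one.\<close>

lemma mu_attained:
  assumes "simple_graph G" "edges G \<noteq> {}"
  shows "fibre_pairs G \<subseteq> conn {(m, m') \<in> fibre_pairs G. size m \<le> mu TYPE('k::field) G}"
proof -
  have fin: "finite (verts G)" and "edges G \<subseteq> Pow (verts G)"
    using assms(1) by (auto simp: simple_graph_def)
  then have fe: "finite (edges G)" using finite_subset by auto
  let ?P = "\<lambda>d. \<exists>F :: ('a cut, 'k) mpoly set. generates_cut_ideal F G \<and> (\<forall>f \<in> F. deg f \<le> d)"
  obtain d where d: "fibre_pairs G \<subseteq> conn {(m, m') \<in> fibre_pairs G. size m \<le> d}"
    using fibre_pairs_conn_bounded[OF fin] by blast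
  have "?P d"
  proof (intro exI conjI)
    show "generates_cut_ideal (binomials {(m, m') \<in> fibre_pairs G. size m \<le> d} :: ('a cut, 'k) mpoly set) G"
      using d by (subst binomials_generate_iff[OF fe assms(2)]) auto
    show "\<forall>f \<in> binomials {(m, m') \<in> fibre_pairs G. size m \<le> d} :: ('a cut, 'k) mpoly set. deg f \<le> d"
      by (auto simp: binomials_def fibre_pairs_def intro!: deg_monom_diff_le)
  qed
  from LeastI[of ?P, OF this] obtain F :: "('a cut, 'k) mpoly set"
    where "generates_cut_ideal F G" "\<forall>f \<in> F. deg f \<le> mu TYPE('k) G"
    unfolding mu_def by blast
  then show ?thesis by (intro degree_bounded_generators_imp_conn[OF fe assms(2)]) auto
qed

text \<open>Moves preserve the degree, and a binomial that applies to a monomial has at most the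
  degree of that monomial.\<close>

lemma conn_restrict_size:
  assumes "\<And>n n'. (n, n') \<in> B \<Longrightarrow> size n = size n'" "(m, m') \<in> conn B" "size m \<le> d"
  shows "(m, m') \<in> conn {(n, n') \<in> B. size n \<le> d}"
proof -
  have "size m' = size m \<and> (m, m') \<in> conn {(n, n') \<in> B. size n \<le> d}"
    using assms(2) unfolding conn_def[of B]
  proof (induction rule: rtrancl_induct)
    case (step y z)
    then obtain p n n' where pn: "y = p + n" "z = p + n'" "(n, n') \<in> B \<or> (n', n) \<in> B"
      unfolding moves_def by blast
    then have sz: "size n = size n'" using assms(1) by metis
    have "size n \<le> d" using step(3) pn(1) assms(3) by simp
    then have "(n, n') \<in> {(n, n') \<in> B. size n \<le> d} \<or> (n', n) \<in> {(n, n') \<in> B. size n \<le> d}"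
      using pn(3) sz by auto
    then have "(y, z) \<in> conn {(n, n') \<in> B. size n \<le> d}"
      unfolding pn by (auto intro: conn_add conn_base conn_sym)
    with step(3) sz pn show ?case by (auto intro: conn_trans)
  qed simp
  then show ?thesis ..
qed

text \<open>Fibres of degree at most \<open>mu\<close> generate everything, and walks inside them
  use only those moves of \<open>B\<close> whose degree is at most \<open>mu\<close>.\<close>

lemma conn_size_le_mu:
  assumes "simple_graph G" "edges G \<noteq> {}" "B \<subseteq> fibre_pairs G" "fibre_pairs G \<subseteq> conn B"
  shows "fibre_pairs G \<subseteq> conn {(n, n') \<in> B. size n \<le> mu TYPE('k::field) G}"
proof (rule subset_trans[OF mu_attained[OF assms(1,2), where 'k = 'k]], rule conn_subset, clarify)
  fix m m' assume "(m, m') \<in> fibre_pairs G" "size m \<le> mu TYPE('k) G"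
  then show "(m, m') \<in> conn {(n, n') \<in> B. size n \<le> mu TYPE('k) G}"
    using assms(3,4) fibre_pairs_size by (intro conn_restrict_size) blast+
qed

section \<open>Cuts, restrictions and gluing\<close>

text \<open>Singling out the part that contains a fixed vertex removes the ambiguity of the
  unordered pair.\<close>

lemma cuts_cases:
  assumes "c \<in> cuts H" "w \<in> verts H"
  obtains A where "w \<in> A" "A \<subseteq> verts H" "c = {A, verts H - A}"
proof -
  obtain A B where c: "c = {A, B}" "A \<union> B = verts H" "A \<inter> B = {}"
    using assms(1) by (auto simp: cuts_def)
  then have "B = verts H - A" "A = verts H - B" by blast+
  then show thesis using that[of A] that[of B] c assms(2) by blast
qed

lemma cutsI: "A \<subseteq> verts H \<Longrightarrow> {A, verts H - A} \<in> cuts H"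
  unfolding cuts_def by blast

lemma separates_cut:
  "A \<subseteq> V \<Longrightarrow> separates {A, V - A} i j \<longleftrightarrow> i \<in> A \<and> j \<in> V - A \<or> i \<in> V - A \<and> j \<in> A"
  by (auto simp: separates_def)

lemma restrict_cut_eq: "X \<subseteq> V \<Longrightarrow> restrict_cut X {A, V - A} = {A \<inter> X, X - A}"
  unfolding restrict_cut_def by auto

lemma separates_restrict_cut:
  assumes "c \<in> cuts H" "X \<subseteq> verts H" "i \<in> X" "j \<in> X"
  shows "separates (restrict_cut X c) i j \<longleftrightarrow> separates c i j"
proof -
  obtain A where A: "A \<subseteq> verts H" "c = {A, verts H - A}"
    using cuts_cases[OF assms(1)] assms(2,3) by blast
  have "restrict_cut X c = {A \<inter> X, X - (A \<inter> X)}"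
    using restrict_cut_eq[OF assms(2)] A by auto
  then show ?thesis
    using separates_cut[of "A \<inter> X" X i j] separates_cut[OF A(1), of i j] A(2) assms by auto
qed

lemma restrict_cut_in_cuts:
  assumes "c \<in> cuts H" "X \<subseteq> verts H"
  shows "restrict_cut X c \<in> cuts (induced H X)"
proof -
  obtain A B where "c = {A, B}" "A \<union> B = verts H" "A \<inter> B = {}"
    using assms(1) by (auto simp: cuts_def)
  then have "restrict_cut X c = {A \<inter> X, B \<inter> X}" "(A \<inter> X) \<union> (B \<inter> X) = X" "(A \<inter> X) \<inter> (B \<inter> X) = {}"
    using assms(2) by (auto simp: restrict_cut_def)
  then show ?thesis unfolding cuts_def induced_def by auto
qed

lemma separates_sym: "separates c i j \<longleftrightarrow> separates c j i"
  unfolding separates_def by blast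

lemma in_cut_pair: "in_cut {i, j} c \<longleftrightarrow> separates c i j"
  unfolding in_cut_def by (metis doubleton_eq_iff separates_sym)

lemma in_cut_pair_fun: "in_cut {i, j} = (\<lambda>c. separates c i j)"
  by (rule ext) (rule in_cut_pair)

section \<open>Heights of monomials and their parity\<close>

lemma size_filter_image_mset:
  "size (filter_mset P (image_mset f M)) = size (filter_mset (\<lambda>x. P (f x)) M)"
  by (induction M) auto

lemma height_add [simp]: "height u v (m + n) = height u v m + height u v n"
  by (simp add: height_def)

lemma height_empty [simp]: "height u v {#} = 0"
  by (simp add: height_def)

lemma height_le_size: "height u v m \<le> size m"
  unfolding height_def by (rule size_filter_mset_lesseq)

lemma image_mset_bool_eq_iff:
  fixes f :: "'a \<Rightarrow> bool" and g :: "'b \<Rightarrow> bool"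
  shows "image_mset f M = image_mset g N \<longleftrightarrow>
    size M = size N \<and> size (filter_mset f M) = size (filter_mset g N)"
proof -
  have T: "count (image_mset h K) True = size (filter_mset h K)"
    and F: "count (image_mset h K) False + size (filter_mset h K) = size K"
    for h :: "'x \<Rightarrow> bool" and K by (induction K) auto
  show ?thesis
  proof
    assume "image_mset f M = image_mset g N"
    then show "size M = size N \<and> size (filter_mset f M) = size (filter_mset g N)"
      using T[of f M] T[of g N] F[of f M] F[of g N] by simp
  next
    assume s: "size M = size N \<and> size (filter_mset f M) = size (filter_mset g N)"
    show "image_mset f M = image_mset g N"
    proof (rule multiset_eqI)
      fix b
      show "count (image_mset f M) b = count (image_mset g N) b"
        using s T[of f M] T[of g N] F[of f M] F[of g N] by (cases b) auto
    qed
  qed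
qed

text \<open>Degree and height packed into one multiset of truth values: in this form the factors of
  two monomials can be matched one by one.\<close>

lemma profile_eq_iff:
  "image_mset (\<lambda>c. separates c u v) m = image_mset (\<lambda>c. separates c u v) m' \<longleftrightarrow>
    size m = size m' \<and> height u v m = height u v m'"
  by (simp add: image_mset_bool_eq_iff height_def)

text \<open>The edge count of \<open>{u, v}\<close> is the height, so the new edge adds the height
  to the invariants and leaves the cuts unchanged.\<close>

lemma fibre_pairs_add_edge:
  "(m, m') \<in> fibre_pairs (add_edge u v H) \<longleftrightarrow>
    (m, m') \<in> fibre_pairs H \<and> height u v m = height u v m'"
  by (auto simp: fibre_pairs_def add_edge_def cut_monomials_def cuts_def height_def in_cut_pair_fun)

lemma cut_monomials_add [simp]:
  "m + n \<in> cut_monomials H \<longleftrightarrow> m \<in> cut_monomials H \<and> n \<in> cut_monomials H"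
  by (auto simp: cut_monomials_def)

lemma fibre_pairs_monomials:
  "(m, m') \<in> fibre_pairs H \<Longrightarrow> m \<in> cut_monomials H \<and> m' \<in> cut_monomials H"
  by (auto simp: fibre_pairs_def)

text \<open>A single cut splits either none or exactly two of the three pairs.\<close>

lemma even_height_triangle:
  assumes "m \<in> cut_monomials H" "x \<in> verts H" "y \<in> verts H" "z \<in> verts H"
  shows "even (height x y m + height y z m + height x z m)"
  using assms(1)
proof (induction m)
  case (add c m)
  then have "c \<in> cuts H" by (simp add: cut_monomials_def)
  then obtain A where A: "A \<subseteq> verts H" "c = {A, verts H - A}"
    using cuts_cases assms(2) by metis
  have "even (of_bool (separates c x y) + of_bool (separates c y z) + of_bool (separates c x z) :: nat)"
    unfolding A(2) separates_cut[OF A(1)] using assms by auto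
  moreover have "even (height x y m + height y z m + height x z m)"
    using add by (simp add: cut_monomials_def)
  ultimately show ?case by (auto simp: height_def split: if_splits)
qed (simp add: height_def)

text \<open>Along a path the number of separated edges determines the separation of the end points
  modulo 2, so heights have a fixed parity on each fibre.\<close>

lemma even_height_fibre:
  assumes "is_path H u xs v" "(m, m') \<in> fibre_pairs H"
  shows "even (height u v m) \<longleftrightarrow> even (height u v m')"
proof -
  have xs: "xs \<noteq> []" "xs ! 0 = u" "xs ! (length xs - 1) = v" "set xs \<subseteq> verts H"
    "\<And>i. Suc i < length xs \<Longrightarrow> {xs ! i, xs ! Suc i} \<in> edges H"
    using assms(1) by (auto simp: is_path_def hd_conv_nth last_conv_nth)
  have m: "m \<in> cut_monomials H" "m' \<in> cut_monomials H"
    using fibre_pairs_monomials[OF assms(2)] by auto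
  have "even (height u (xs ! i) m) \<longleftrightarrow> even (height u (xs ! i) m')" if "i < length xs" for i
    using that
  proof (induction i)
    case 0
    have "u \<in> verts H" using xs nth_mem[of 0 xs] by auto
    then have "height u u n = 0" if "n \<in> cut_monomials H" for n
      using that cuts_cases separates_cut
      by (auto simp: height_def cut_monomials_def filter_mset_eq_mempty_iff separates_def cuts_def)
    then show ?case using xs(2) m by simp
  next
    case (Suc i)
    let ?x = "xs ! i" and ?y = "xs ! Suc i"
    have V: "u \<in> verts H" "?x \<in> verts H" "?y \<in> verts H"
      using Suc.prems xs nth_mem[of 0 xs] nth_mem[of i xs] nth_mem[of "Suc i" xs] by auto
    have "height ?x ?y m = height ?x ?y m'"
      using assms(2) xs(5)[OF Suc.prems] by (auto simp: fibre_pairs_def height_def in_cut_pair_fun)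
    moreover have "even (height u ?x m) \<longleftrightarrow> even (height u ?x m')"
      using Suc by simp
    ultimately show ?case
      using even_height_triangle[OF m(1) V] even_height_triangle[OF m(2) V] by simp
  qed
  then show ?thesis using xs(1,3) by (metis diff_less length_greater_0_conv zero_less_one)
qed

text \<open>A walk that ends above its initial height has a move crossing that height. Its change is
  even by parity and at most 2 by slow variation, and its start has the parity of \<open>m\<close>;
  so it starts exactly at the initial height. The start \<open>p + n\<close> need not be
  \<open>m\<close>: it only shares its fibre and height.\<close>

lemma conn_height_jump:
  assumes B: "B \<subseteq> fibre_pairs H"
    and slow: "\<And>n n'. (n, n') \<in> B \<Longrightarrow> \<bar>int (height u v n) - int (height u v n')\<bar> \<le> 2"
    and path: "is_path H u xs v"
    and c: "(m, m') \<in> conn B" and m: "m \<in> cut_monomials H" and h: "height u v m < height u v m'"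
  obtains p n n' where "(n, n') \<in> B \<or> (n', n) \<in> B" "(m, p + n) \<in> fibre_pairs H"
    "height u v (p + n) = height u v m" "height u v (p + n') = height u v m + 2"
proof -
  let ?h = "height u v"
  have "?h m' \<le> ?h m \<or> (\<exists>p n n'. ((n, n') \<in> B \<or> (n', n) \<in> B) \<and> (m, p + n) \<in> fibre_pairs H \<and>
      ?h (p + n) = ?h m \<and> ?h (p + n') = ?h m + 2)"
    using c unfolding conn_def
  proof (induction rule: rtrancl_induct)
    case (step y z)
    show ?case
    proof (cases "?h y \<le> ?h m \<and> ?h m < ?h z")
      case True
      obtain p n n' where pn: "y = p + n" "z = p + n'" "(n, n') \<in> B \<or> (n', n) \<in> B"
        using step(2) unfolding moves_def by blast
      have my: "(m, y) \<in> fibre_pairs H"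
        using conn_fibre_pairs[OF B _ m] step(1) unfolding conn_def by blast
      have nn: "(n, n') \<in> fibre_pairs H" using pn(3) B fibre_pairs_sym by blast
      have "even (?h m) \<longleftrightarrow> even (?h y)" by (rule even_height_fibre[OF path my])
      moreover have "even (?h n) \<longleftrightarrow> even (?h n')" by (rule even_height_fibre[OF path nn])
      moreover have "\<bar>int (?h n) - int (?h n')\<bar> \<le> 2" using pn(3) slow by (metis abs_minus_commute)
      ultimately have "?h y = ?h m \<and> ?h z = ?h m + 2"
        using True unfolding pn(1,2) height_add by presburger
      then show ?thesis using pn my by blast
    next
      case False
      with step show ?thesis by auto
    qed
  qed simp
  then obtain p n n' where "(n, n') \<in> B \<or> (n', n) \<in> B" "(m, p + n) \<in> fibre_pairs H"
    "?h (p + n) = ?h m" "?h (p + n') = ?h m + 2"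
  proof (rule disjE)
    assume "?h m' \<le> ?h m"
    with h show ?thesis by simp
  next
    assume "\<exists>p n n'. ((n, n') \<in> B \<or> (n', n) \<in> B) \<and> (m, p + n) \<in> fibre_pairs H \<and>
      ?h (p + n) = ?h m \<and> ?h (p + n') = ?h m + 2"
    then show ?thesis using that by blast
  qed
  then show thesis by (rule that)
qed


text \<open>Aligns the ordered factors of a monomial of \<open>G\<close> with those of a monomial of
  \<open>G[L]\<close> once their heights form the same multiset.\<close>

lemma sorted_desc_unique:
  fixes xs ys :: "'x::linorder list"
  assumes "sorted_wrt (\<ge>) xs" "sorted_wrt (\<ge>) ys" "mset xs = mset ys"
  shows "xs = ys"
proof -
  have "sorted (rev xs)" "sorted (rev ys)" using assms by (simp_all add: sorted_wrt_rev)
  then have "sort (rev ys) = rev xs" "sort (rev ys) = rev ys"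
    using assms(3) by (auto intro: properties_for_sort)
  then show ?thesis by simp
qed

lemma ex_sorted_desc_list:
  fixes g :: "'x \<Rightarrow> 'y::linorder"
  obtains xs where "mset xs = M" "sorted_wrt (\<ge>) (map g xs)"
proof -
  obtain ys where "mset ys = M" using ex_mset by blast
  then show thesis
    using that[of "rev (sort_key g ys)"] by (simp add: sorted_wrt_rev rev_map[symmetric])
qed

text \<open>Selects the padding of a join: prescribed numbers of factors that separate
  \<open>u\<close> and \<open>v\<close> and of factors that do not.\<close>

lemma ex_submset_size_filter:
  fixes P :: "'x \<Rightarrow> bool"
  assumes "i \<le> size (filter_mset P M)" "j \<le> size (filter_mset (\<lambda>x. \<not> P x) M)"
  obtains N where "N \<subseteq># M" "size (filter_mset P N) = i" "size (filter_mset (\<lambda>x. \<not> P x) N) = j"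
proof -
  have ex: "\<exists>N. N \<subseteq># K \<and> size N = k" if "k \<le> size K" for k and K :: "'x multiset"
    using that
  proof (induction K arbitrary: k)
    case (add x K)
    show ?case
    proof (cases k)
      case (Suc k')
      with add obtain N where "N \<subseteq># K" "size N = k'" by auto
      then show ?thesis using Suc by (intro exI[of _ "add_mset x N"]) simp
    qed (simp add: exI[of _ "{#}"])
  qed simp
  obtain N1 N2 where N: "N1 \<subseteq># filter_mset P M" "size N1 = i"
    "N2 \<subseteq># filter_mset (\<lambda>x. \<not> P x) M" "size N2 = j" using ex assms by metis
  have "filter_mset P N1 = N1" "filter_mset (\<lambda>x. \<not> P x) N2 = N2"
    "filter_mset P N2 = {#}" "filter_mset (\<lambda>x. \<not> P x) N1 = {#}"
    using N by (auto simp: filter_mset_eq_conv filter_mset_eq_mempty_iff dest!: mset_subset_eqD)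
  moreover have "N1 + N2 \<subseteq># M"
    using subset_mset.add_mono[OF N(1,3)] multiset_partition[of M P] by simp
  ultimately show thesis using that[of "N1 + N2"] N by simp
qed

text \<open>The data of \<open>lifts\<close> as ordered pairs of monomials, on which
  \<open>conn\<close> acts; a difference of polynomials would lose the monomials when it is zero.
  \<open>join_pairs\<close> and \<open>reorder_pairs\<close> serve the same purpose.\<close>

definition lift_pairs ::
    "'a graph \<Rightarrow> 'a \<Rightarrow> 'a \<Rightarrow> 'a set \<Rightarrow> 'a set \<Rightarrow> ('a cut, 'k::field) mpoly set
      \<Rightarrow> ('a cut monomial \<times> 'a cut monomial) set" where
  "lift_pairs G u v L R F =
     {(mset cs, mset cs') | cs cs'.
        set cs \<subseteq> cuts G \<and> set cs' \<subseteq> cuts G \<and> length cs = length cs' \<and>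
        sorted_wrt (\<ge>) (map (\<lambda>c. height u v {#c#}) cs) \<and>
        sorted_wrt (\<ge>) (map (\<lambda>c. height u v {#c#}) cs') \<and>
        monom (mset (map (restrict_cut L) cs)) - monom (mset (map (restrict_cut L) cs')) \<in> F \<and>
        (\<forall>i < length cs. restrict_cut R (cs ! i) = restrict_cut R (cs' ! i))}"

lemma lift_pairsI:
  assumes "set cs \<subseteq> cuts G" "set cs' \<subseteq> cuts G" "length cs = length cs'"
    "sorted_wrt (\<ge>) (map (\<lambda>c. height u v {#c#}) cs)" "sorted_wrt (\<ge>) (map (\<lambda>c. height u v {#c#}) cs')"
    "monom (mset (map (restrict_cut L) cs)) - monom (mset (map (restrict_cut L) cs')) \<in> F"
    "map (restrict_cut R) cs = map (restrict_cut R) cs'"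
  shows "(mset cs, mset cs') \<in> lift_pairs G u v L R F"
proof -
  have "\<forall>i < length cs. restrict_cut R (cs ! i) = restrict_cut R (cs' ! i)"
    using assms(3,7) by (metis nth_map)
  with assms(1-6) show ?thesis
    unfolding lift_pairs_def by (intro CollectI exI[of _ cs] exI[of _ cs'] conjI refl)
qed

definition join_pairs ::
    "'a graph \<Rightarrow> 'a \<Rightarrow> 'a \<Rightarrow> 'a set \<Rightarrow> 'a set \<Rightarrow> ('a cut, 'k::field) mpoly set
      \<Rightarrow> ('a cut, 'k) mpoly set \<Rightarrow> ('a cut monomial \<times> 'a cut monomial) set" where
  "join_pairs G u v L R F\<^sub>L F\<^sub>R =
     {(Q, Q') | Q Q'. \<exists>q\<^sub>1 q\<^sub>2 q\<^sub>3 q\<^sub>4.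
        up_to_sign F\<^sub>L q\<^sub>1 q\<^sub>2 \<and> up_to_sign F\<^sub>R q\<^sub>3 q\<^sub>4 \<and>
        \<bar>int (height u v q\<^sub>1) - int (height u v q\<^sub>2)\<bar> = 2 \<and>
        \<bar>int (height u v q\<^sub>3) - int (height u v q\<^sub>4)\<bar> = 2 \<and>
        is_join G u v L R (max_degree (F\<^sub>L \<union> F\<^sub>R)) q\<^sub>1 q\<^sub>2 q\<^sub>3 q\<^sub>4 Q Q'}"

definition reorder_pairs ::
    "'a graph \<Rightarrow> 'a set \<Rightarrow> 'a set \<Rightarrow> ('a cut monomial \<times> 'a cut monomial) set" where
  "reorder_pairs G L R =
     {({#{C\<^sub>1, D\<^sub>1}, {C\<^sub>2, D\<^sub>2}#}, {#{C\<^sub>1', D\<^sub>1'}, {C\<^sub>2', D\<^sub>2'}#})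
        | C\<^sub>1 D\<^sub>1 C\<^sub>2 D\<^sub>2 C\<^sub>1' D\<^sub>1' C\<^sub>2' D\<^sub>2'.
        {{C\<^sub>1, D\<^sub>1}, {C\<^sub>2, D\<^sub>2}, {C\<^sub>1', D\<^sub>1'}, {C\<^sub>2', D\<^sub>2'}} \<subseteq> cuts G \<and>
        C\<^sub>1 \<inter> L = C\<^sub>1' \<inter> L \<and> C\<^sub>2 \<inter> L = C\<^sub>2' \<inter> L \<and>
        C\<^sub>1 \<inter> R = C\<^sub>2' \<inter> R \<and> C\<^sub>2 \<inter> R = C\<^sub>1' \<inter> R}"

section \<open>Translation between sets of polynomials and sets of pairs\<close>

lemma mem_binomials: "f \<in> binomials B \<longleftrightarrow> (\<exists>m m'. (m, m') \<in> B \<and> f = monom m - monom m')"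
  unfolding binomials_def by auto

lemma binomials_Collect2:
  "binomials {(f x y, g x y) | x y. P x y} = {monom (f x y) - monom (g x y) | x y. P x y}"
  unfolding mem_binomials set_eq_iff by blast

lemma binomials_Collect8:
  "(binomials {(f a b c d a' b' c' d', g a b c d a' b' c' d') | a b c d a' b' c' d'.
      P a b c d a' b' c' d'} :: ('x, 'k::field) mpoly set) =
   {monom (f a b c d a' b' c' d') - monom (g a b c d a' b' c' d') | a b c d a' b' c' d'.
      P a b c d a' b' c' d'}" (is "binomials ?A = ?B")
proof (intro subset_antisym subsetI)
  fix x :: "('x, 'k) mpoly" assume "x \<in> binomials ?A"
  then obtain a b c d a' b' c' d' where P: "P a b c d a' b' c' d'"
    and x: "x = monom (f a b c d a' b' c' d') - monom (g a b c d a' b' c' d')"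
    unfolding mem_binomials by (elim exE CollectE conjE Pair_inject) simp
  show "x \<in> ?B" by (rule CollectI, (rule exI)+, rule conjI[OF x P])
next
  fix x :: "('x, 'k) mpoly" assume "x \<in> ?B"
  then obtain a b c d a' b' c' d' where P: "P a b c d a' b' c' d'"
    and x: "x = monom (f a b c d a' b' c' d') - monom (g a b c d a' b' c' d')"
    by (elim CollectE exE conjE)
  have "(f a b c d a' b' c' d', g a b c d a' b' c' d') \<in> ?A"
    by (rule CollectI, (rule exI)+, rule conjI[OF refl P])
  with x show "x \<in> binomials ?A" unfolding mem_binomials by (intro exI conjI)
qed

lemma lifts_eq: "lifts G u v L R F = binomials (lift_pairs G u v L R F)"
  unfolding lifts_def lift_pairs_def by (simp only: binomials_Collect2)

lemma joins_eq:
  "(joins G u v L R F\<^sub>L F\<^sub>R :: ('a cut, 'k::field) mpoly set) = binomials (join_pairs G u v L R F\<^sub>L F\<^sub>R)"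
proof (intro subset_antisym subsetI)
  fix f :: "('a cut, 'k) mpoly" assume "f \<in> joins G u v L R F\<^sub>L F\<^sub>R"
  then obtain Q Q' where "(Q, Q') \<in> join_pairs G u v L R F\<^sub>L F\<^sub>R" "f = monom Q - monom Q'"
    unfolding joins_def join_pairs_def mem_Collect_eq prod.inject by metis
  then show "f \<in> binomials (join_pairs G u v L R F\<^sub>L F\<^sub>R)" unfolding mem_binomials by blast
next
  fix f :: "('a cut, 'k) mpoly" assume "f \<in> binomials (join_pairs G u v L R F\<^sub>L F\<^sub>R)"
  then show "f \<in> joins G u v L R F\<^sub>L F\<^sub>R"
    unfolding joins_def join_pairs_def mem_binomials mem_Collect_eq prod.inject by metis
qed

lemma reorderings_eq:
  "(reorderings G L R :: ('a cut, 'k::field) mpoly set) = binomials (reorder_pairs G L R)"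
  unfolding reorderings_def reorder_pairs_def by (rule binomials_Collect8[symmetric])

section \<open>Two graphs glued along a pair of vertices\<close>

locale two_sum =
  fixes G :: "'a graph" and u v :: 'a and L R :: "'a set"
  assumes simple: "simple_graph G"
    and uv: "u \<noteq> v" "{u, v} \<notin> edges G"
    and LR: "L \<union> R = verts G" "L \<inter> R = {u, v}"
    and edges_LR: "edges G = edges (induced G L) \<union> edges (induced G R)"
begin

text \<open>The setting is symmetric, so statements about \<open>L\<close> yield those about
  \<open>R\<close> by interpretation.\<close>

lemma two_sum_swap: "two_sum G u v R L"
  using simple uv LR edges_LR by unfold_locales auto

abbreviation sep :: "'a cut \<Rightarrow> bool" where "sep \<equiv> \<lambda>c. separates c u v"
abbreviation restrL :: "'a cut \<Rightarrow> 'a cut" where "restrL \<equiv> restrict_cut L"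
abbreviation restrR :: "'a cut \<Rightarrow> 'a cut" where "restrR \<equiv> restrict_cut R"
abbreviation GL :: "'a graph" where "GL \<equiv> induced G L"
abbreviation GR :: "'a graph" where "GR \<equiv> induced G R"

lemma verts_LR: "u \<in> L" "v \<in> L" "u \<in> R" "v \<in> R" "L \<subseteq> verts G" "R \<subseteq> verts G"
    "u \<in> verts G" "v \<in> verts G" "verts GL = L" "verts GR = R"
  using LR by (auto simp: induced_def)

lemma sep_restrL: "c \<in> cuts G \<Longrightarrow> sep (restrL c) = sep c"
  by (rule separates_restrict_cut[OF _ verts_LR(5,1,2)])

lemma sep_restrR: "c \<in> cuts G \<Longrightarrow> sep (restrR c) = sep c"
  by (rule separates_restrict_cut[OF _ verts_LR(6,3,4)])

lemma restrL_in_cuts: "c \<in> cuts G \<Longrightarrow> restrL c \<in> cuts GL"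
  by (rule restrict_cut_in_cuts[OF _ verts_LR(5)])

lemma restr_monomialsL: "Q \<in> cut_monomials G \<Longrightarrow> image_mset restrL Q \<in> cut_monomials GL"
  using restrL_in_cuts by (auto simp: cut_monomials_def)

lemma profile_restrL:
  "Q \<in> cut_monomials G \<Longrightarrow> image_mset sep (image_mset restrL Q) = image_mset sep Q"
  unfolding multiset.map_comp by (rule image_mset_cong) (auto simp: cut_monomials_def sep_restrL)

lemma height_restrL: "Q \<in> cut_monomials G \<Longrightarrow> height u v (image_mset restrL Q) = height u v Q"
  using profile_restrL[unfolded profile_eq_iff] by blast

text \<open>The parts containing \<open>u\<close> agree at \<open>v\<close> by the hypothesis on
  separation, hence on all of \<open>L \<inter> R\<close>. Their union therefore restricts back to
  each of them.\<close>

lemma glue: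
  assumes a: "a \<in> cuts GL" and b: "b \<in> cuts GR" and sep: "sep a = sep b"
  obtains c where "c \<in> cuts G" "restrL c = a" "restrR c = b"
proof -
  obtain A where A: "u \<in> A" "A \<subseteq> L" "a = {A, L - A}"
    using cuts_cases[OF a, of u] verts_LR by auto
  obtain B where B: "u \<in> B" "B \<subseteq> R" "b = {B, R - B}"
    using cuts_cases[OF b, of u] verts_LR by auto
  have "v \<in> A \<longleftrightarrow> v \<in> B"
    using sep A B verts_LR separates_cut[OF A(2), of u v] separates_cut[OF B(2), of u v] by auto
  then have AB: "(A \<union> B) \<inter> L = A" "(A \<union> B) \<inter> R = B" "L - (A \<union> B) = L - A" "R - (A \<union> B) = R - B"
    using A(1,2) B(1,2) LR(2) by auto
  have "A \<union> B \<subseteq> verts G" using A B LR by blast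
  from cutsI[OF this] show thesis
    by (rule that) (simp_all add: restrict_cut_eq verts_LR AB A(3) B(3))
qed

text \<open>As \<open>u\<close> lies in both \<open>L\<close> and \<open>R\<close>, the part
  containing \<open>u\<close> can be followed on both sides, and its two traces determine
  it.\<close>

lemma cut_eqI:
  assumes c: "c \<in> cuts G" "c' \<in> cuts G" and e: "restrL c = restrL c'" "restrR c = restrR c'"
  shows "c = c'"
proof -
  obtain A where A: "u \<in> A" "A \<subseteq> verts G" "c = {A, verts G - A}"
    using cuts_cases[OF c(1) verts_LR(7)] .
  obtain A' where A': "u \<in> A'" "A' \<subseteq> verts G" "c' = {A', verts G - A'}"
    using cuts_cases[OF c(2) verts_LR(7)] .
  have "{A \<inter> L, L - A} = {A' \<inter> L, L - A'}" "{A \<inter> R, R - A} = {A' \<inter> R, R - A'}"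
    using e A A' by (simp_all add: restrict_cut_eq verts_LR)
  moreover have "u \<in> A \<inter> L" "u \<in> A' \<inter> L" "u \<notin> L - A'" "u \<in> A \<inter> R" "u \<in> A' \<inter> R" "u \<notin> R - A'"
    using A A' verts_LR by auto
  ultimately have "A \<inter> L = A' \<inter> L" "A \<inter> R = A' \<inter> R" by (metis doubleton_eq_iff)+
  then have "A = A'" using A A' LR by blast
  then show ?thesis using A A' by simp
qed

lemma in_cut_restrL:
  assumes "e \<in> edges GL" "c \<in> cuts G"
  shows "in_cut e (restrL c) \<longleftrightarrow> in_cut e c"
proof -
  from assms(1) have "e \<in> edges G" "e \<subseteq> L" by (auto simp: induced_def)
  then obtain i j where "e = {i, j}" using simple unfolding simple_graph_def by blast
  then show ?thesis
    using separates_restrict_cut[OF assms(2) verts_LR(5), of i j] \<open>e \<subseteq> L\<close> by (simp add: in_cut_pair)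
qed

lemma size_filter_in_cut_restrL:
  assumes "e \<in> edges GL" "Q \<in> cut_monomials G"
  shows "size (filter_mset (in_cut e) (image_mset restrL Q)) = size (filter_mset (in_cut e) Q)"
  unfolding size_filter_image_mset
  by (rule arg_cong[where f = size], rule filter_mset_cong)
    (use assms in \<open>auto simp: in_cut_restrL cut_monomials_def\<close>)

end

context two_sum
begin

interpretation swap: two_sum G u v R L by (rule two_sum_swap)

lemma restr_monomialsR: "Q \<in> cut_monomials G \<Longrightarrow> image_mset restrR Q \<in> cut_monomials GR"
  by (rule swap.restr_monomialsL)

lemma height_restrR: "Q \<in> cut_monomials G \<Longrightarrow> height u v (image_mset restrR Q) = height u v Q"
  by (rule swap.height_restrL)

lemma restrR_in_cuts: "c \<in> cuts G \<Longrightarrow> restrR c \<in> cuts GR"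
  by (rule swap.restrL_in_cuts)

text \<open>Every edge lies inside \<open>L\<close> or inside \<open>R\<close>, and restriction
  preserves the degree and the counts of the edges it keeps.\<close>

lemma fibre_pairs_iff:
  assumes "Q \<in> cut_monomials G" "Q' \<in> cut_monomials G"
  shows "(Q, Q') \<in> fibre_pairs G \<longleftrightarrow>
    (image_mset restrL Q, image_mset restrL Q') \<in> fibre_pairs GL \<and>
    (image_mset restrR Q, image_mset restrR Q') \<in> fibre_pairs GR"
  using assms edges_LR
  by (auto simp: fibre_pairs_def size_filter_in_cut_restrL swap.size_filter_in_cut_restrL
      restr_monomialsL restr_monomialsR)

text \<open>Equal profiles provide, for each factor on the left, a factor on the right with which it
  can be glued. The matching is arbitrary; reorderings later compensate for the choice.\<close>

lemma realize:
  assumes "P \<in> cut_monomials GL" "P' \<in> cut_monomials GR" "image_mset sep P = image_mset sep P'"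
  obtains N where "N \<in> cut_monomials G" "image_mset restrL N = P" "image_mset restrR N = P'"
proof -
  have "\<exists>N. N \<in> cut_monomials G \<and> image_mset restrL N = P \<and> image_mset restrR N = P'"
    using assms
  proof (induction P arbitrary: P')
    case empty
    then show ?case by (intro exI[of _ "{#}"]) (simp add: cut_monomials_def)
  next
    case (add a P)
    then have "sep a \<in># image_mset sep P'" by (metis image_mset_add_mset union_single_eq_member)
    then obtain b where b: "b \<in># P'" "sep b = sep a" by auto
    then obtain P'' where P': "P' = add_mset b P''" by (metis insert_DiffM)
    have ab: "a \<in> cuts GL" "b \<in> cuts GR" "P \<in> cut_monomials GL" "P'' \<in> cut_monomials GR"
      using add.prems P' by (auto simp: cut_monomials_def)
    obtain c where c: "c \<in> cuts G" "restrL c = a" "restrR c = b"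
      using glue[OF ab(1,2)] b(2) by metis
    obtain N where "N \<in> cut_monomials G" "image_mset restrL N = P" "image_mset restrR N = P''"
      using add.IH[OF ab(3,4)] add.prems(3) P' b(2) by auto
    with c show ?case
      by (intro exI[of _ "add_mset c N"]) (simp add: cut_monomials_def P')
  qed
  with that show thesis by blast
qed

text \<open>Listing the part that contains \<open>u\<close> first is a suitable order: equal
  restrictions then become equal traces.\<close>

lemma reorder_pair:
  assumes c: "c\<^sub>1 \<in> cuts G" "c\<^sub>2 \<in> cuts G" "d\<^sub>1 \<in> cuts G" "d\<^sub>2 \<in> cuts G"
    and e: "restrL c\<^sub>1 = restrL d\<^sub>1" "restrL c\<^sub>2 = restrL d\<^sub>2"
      "restrR c\<^sub>1 = restrR d\<^sub>2" "restrR c\<^sub>2 = restrR d\<^sub>1"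
  shows "({#c\<^sub>1, c\<^sub>2#}, {#d\<^sub>1, d\<^sub>2#}) \<in> reorder_pairs G L R"
proof -
  let ?V = "verts G"
  obtain A\<^sub>1 A\<^sub>2 B\<^sub>1 B\<^sub>2 where A: "u \<in> A\<^sub>1" "c\<^sub>1 = {A\<^sub>1, ?V - A\<^sub>1}" "u \<in> A\<^sub>2" "c\<^sub>2 = {A\<^sub>2, ?V - A\<^sub>2}"
    "u \<in> B\<^sub>1" "d\<^sub>1 = {B\<^sub>1, ?V - B\<^sub>1}" "u \<in> B\<^sub>2" "d\<^sub>2 = {B\<^sub>2, ?V - B\<^sub>2}"
    using c cuts_cases verts_LR(7) by metis
  have eq: "A \<inter> X = B \<inter> X"
    if "restrict_cut X {A, ?V - A} = restrict_cut X {B, ?V - B}" "u \<in> A" "u \<in> B" "u \<in> X" "X \<subseteq> ?V"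
    for A B X
    using that by (auto simp: restrict_cut_eq doubleton_eq_iff)
  have "A\<^sub>1 \<inter> L = B\<^sub>1 \<inter> L" "A\<^sub>2 \<inter> L = B\<^sub>2 \<inter> L" "A\<^sub>1 \<inter> R = B\<^sub>2 \<inter> R" "A\<^sub>2 \<inter> R = B\<^sub>1 \<inter> R"
    using e A(1,3,5,7) verts_LR unfolding A(2,4,6,8) by (intro eq; simp)+
  then show ?thesis using c A unfolding reorder_pairs_def by blast
qed

text \<open>The two monomials differ only in how left halves are matched with right halves. One
  exchange makes the factor \<open>c\<close> appear in \<open>Q'\<close>, and induction handles the
  rest.\<close>

lemma reorder_conn:
  assumes "Q \<in> cut_monomials G" "Q' \<in> cut_monomials G"
    "image_mset restrL Q = image_mset restrL Q'" "image_mset restrR Q = image_mset restrR Q'"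
  shows "(Q, Q') \<in> conn (reorder_pairs G L R)"
  using assms
proof (induction Q arbitrary: Q')
  case empty
  then show ?case by simp
next
  case (add c Q)
  have c: "c \<in> cuts G" "Q \<in> cut_monomials G" using add.prems(1) by (simp_all add: cut_monomials_def)
  have "restrL c \<in># image_mset restrL Q'" "restrR c \<in># image_mset restrR Q'"
    using add.prems(3,4) by (metis image_mset_add_mset union_single_eq_member)+
  then obtain d\<^sub>1 d\<^sub>2 where d: "d\<^sub>1 \<in># Q'" "restrL d\<^sub>1 = restrL c" "d\<^sub>2 \<in># Q'" "restrR d\<^sub>2 = restrR c"
    by auto
  have dc: "d\<^sub>1 \<in> cuts G" "d\<^sub>2 \<in> cuts G" using d add.prems(2) by (auto simp: cut_monomials_def)
  show ?case
  proof (cases "c \<in># Q'")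
    case True
    then obtain Q'' where Q': "Q' = add_mset c Q''" by (metis insert_DiffM)
    then have "(Q, Q'') \<in> conn (reorder_pairs G L R)"
      using add.prems c by (intro add.IH) (simp_all add: cut_monomials_def)
    from conn_add[OF this, of "{#c#}"] show ?thesis by (simp add: Q')
  next
    case False
    then have "d\<^sub>1 \<noteq> d\<^sub>2" using cut_eqI[OF dc(1) c(1)] d by auto
    then obtain Q'' where Q': "Q' = {#d\<^sub>1, d\<^sub>2#} + Q''"
    proof -
      have "{#d\<^sub>1#} \<subseteq># Q'" "d\<^sub>2 \<in># Q' - {#d\<^sub>1#}"
        using d \<open>d\<^sub>1 \<noteq> d\<^sub>2\<close> by (simp_all add: in_diff_count)
      then have "Q' = {#d\<^sub>1, d\<^sub>2#} + (Q' - {#d\<^sub>1#} - {#d\<^sub>2#})"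
        using d(1) by (metis add_mset_add_single add_mset_commute insert_DiffM union_mset_add_mset_left
            empty_neutral(1))
      then show thesis by (rule that)
    qed
    \<comment> \<open>\<open>d\<^sub>1\<close> has the left half of \<open>c\<close> and
      \<open>d\<^sub>2\<close> its right half. Both separate \<open>u\<close> and \<open>v\<close>
      exactly if \<open>c\<close> does, so the other two halves can be glued to a cut
      \<open>b\<close>.\<close>
    have "sep (restrL d\<^sub>2) = sep (restrR d\<^sub>1)"
      using d dc c sep_restrL sep_restrR by metis
    then obtain b where b: "b \<in> cuts G" "restrL b = restrL d\<^sub>2" "restrR b = restrR d\<^sub>1"
      using glue[OF restrL_in_cuts[OF dc(2)] restrR_in_cuts[OF dc(1)]] by metis
    have "({#d\<^sub>1, d\<^sub>2#}, {#c, b#}) \<in> reorder_pairs G L R"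
      using reorder_pair[OF dc c(1) b(1)] d b by simp
    from conn_sym[OF conn_add[OF conn_base[OF this], of Q'']]
    have 1: "({#c, b#} + Q'', Q') \<in> conn (reorder_pairs G L R)"
      unfolding Q' by (simp add: add.commute)
    have "(Q, add_mset b Q'') \<in> conn (reorder_pairs G L R)"
      using add.prems c b d by (intro add.IH) (simp_all add: cut_monomials_def Q' add_mset_commute)
    from conn_add[OF this, of "{#c#}"]
    have "(add_mset c Q, {#c, b#} + Q'') \<in> conn (reorder_pairs G L R)"
      by (simp add: add_mset_commute)
    then show ?thesis using 1 by (rule conn_trans)
  qed
qed

text \<open>In decreasing order of height the separating factors come first, and equal heights put
  the change at the same position in both lists. Each factor of \<open>n'\<close> can thus be glued
  to the right half at its position.\<close>

lemma lift_step:
  fixes F :: "('a cut, 'k::field) mpoly set"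
  assumes Q: "Q \<in> cut_monomials G" "image_mset restrL Q = p + n"
    and n': "n' \<in> cut_monomials GL" "image_mset sep n = image_mset sep n'"
    and F: "monom n - monom n' \<in> F \<or> monom n' - monom n \<in> F"
  obtains Q' where "Q' \<in> cut_monomials G" "image_mset restrL Q' = p + n'"
    "image_mset restrR Q' = image_mset restrR Q" "(Q, Q') \<in> conn (lift_pairs G u v L R F)"
proof -
  let ?h = "\<lambda>c. height u v {#c#}"
  have h: "?h c = of_bool (sep c)" for c by (simp add: height_def)
  \<comment> \<open>Only the factors over \<open>n\<close> are exchanged; \<open>Q\<^sub>0\<close>
    is the multiplier of the lifted move.\<close>
  obtain Q\<^sub>0 Q\<^sub>1 where Q01: "Q = Q\<^sub>0 + Q\<^sub>1" "image_mset restrL Q\<^sub>0 = p" "image_mset restrL Q\<^sub>1 = n"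
    using image_mset_eq_plusD[OF Q(2)] by blast
  obtain cs where cs: "mset cs = Q\<^sub>1" "sorted_wrt (\<ge>) (map ?h cs)"
    using ex_sorted_desc_list[of Q\<^sub>1 ?h] by blast
  obtain xs where xs: "mset xs = n'" "sorted_wrt (\<ge>) (map ?h xs)"
    using ex_sorted_desc_list[of n' ?h] by blast
  have csG: "set cs \<subseteq> cuts G" using Q(1) Q01 cs(1) by (auto simp: cut_monomials_def)
  have xsL: "set xs \<subseteq> cuts GL" using n'(1) xs(1) by (auto simp: cut_monomials_def)
  have "image_mset sep Q\<^sub>1 = image_mset sep n'"
    using profile_restrL[of Q\<^sub>1] Q Q01 n'(2) by simp
  then have "image_mset of_bool (image_mset sep Q\<^sub>1) = (image_mset of_bool (image_mset sep n') :: nat multiset)"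
    by simp
  then have "mset (map ?h cs) = mset (map ?h xs)"
    by (simp add: cs(1)[symmetric] xs(1)[symmetric] h multiset.map_comp comp_def)
  from sorted_desc_unique[OF cs(2) xs(2) this] have hh: "map ?h cs = map ?h xs" .
  then have len: "length cs = length xs" by (metis length_map)
  have seps: "sep (cs ! i) = sep (xs ! i)" if "i < length cs" for i
  proof -
    have "?h (cs ! i) = ?h (xs ! i)"
      using that len hh by (metis nth_map)
    then show ?thesis by (simp add: h of_bool_eq_iff)
  qed
  have "\<exists>c. c \<in> cuts G \<and> restrL c = xs ! i \<and> restrR c = restrR (cs ! i)" if "i < length cs" for i
  proof -
    have i: "cs ! i \<in> cuts G" "xs ! i \<in> cuts GL" using that len csG xsL by auto
    show ?thesis
      using glue[OF i(2) restrR_in_cuts[OF i(1)]] seps[OF that] sep_restrR[OF i(1)] by metis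
  qed
  then obtain g where g: "\<And>i. i < length cs \<Longrightarrow>
      g i \<in> cuts G \<and> restrL (g i) = xs ! i \<and> restrR (g i) = restrR (cs ! i)"
    by metis
  define cs' where "cs' = map g [0..<length cs]"
  have cs'G: "set cs' \<subseteq> cuts G" using g by (auto simp: cs'_def)
  have L': "map restrL cs' = xs" by (rule nth_equalityI) (use g len in \<open>simp_all add: cs'_def\<close>)
  have R': "map restrR cs' = map restrR cs" by (rule nth_equalityI) (use g in \<open>simp_all add: cs'_def\<close>)
  have "map ?h cs' = map ?h xs"
  proof (rule nth_equalityI)
    fix i assume "i < length (map ?h cs')"
    then show "map ?h cs' ! i = map ?h xs ! i"
      using g len sep_restrL[of "g i"] by (simp add: cs'_def h)
  qed (simp add: cs'_def len)
  with xs(2) have srt: "sorted_wrt (\<ge>) (map ?h cs')" by simp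
  have mL: "mset (map restrL cs) = n" "mset (map restrL cs') = n'"
    using Q01(3) cs(1) L' xs(1) by simp_all
  have len': "length cs' = length cs" by (simp add: cs'_def)
  from F have "(mset cs, mset cs') \<in> conn (lift_pairs G u v L R F)"
  proof
    assume "monom n - monom n' \<in> F"
    then have "(mset cs, mset cs') \<in> lift_pairs G u v L R F"
      using csG cs'G len' cs(2) srt R' mL by (intro lift_pairsI) simp_all
    then show ?thesis by (rule conn_base)
  next
    assume "monom n' - monom n \<in> F"
    then have "(mset cs', mset cs) \<in> lift_pairs G u v L R F"
      using csG cs'G len' cs(2) srt R' mL by (intro lift_pairsI) simp_all
    then show ?thesis by (intro conn_sym[OF conn_base])
  qed
  from conn_add[OF this, of Q\<^sub>0]
  have "(Q, Q\<^sub>0 + mset cs') \<in> conn (lift_pairs G u v L R F)" using Q01 cs by simp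
  moreover have "Q\<^sub>0 + mset cs' \<in> cut_monomials G"
    using Q(1) Q01(1) cs'G by (auto simp: cut_monomials_def)
  moreover have "image_mset restrL (Q\<^sub>0 + mset cs') = p + n'" using Q01(2) mL by simp
  moreover have "image_mset restrR (Q\<^sub>0 + mset cs') = image_mset restrR Q"
    using R' Q01(1) cs(1) by (metis image_mset_union mset_map)
  ultimately show thesis by (intro that)
qed

lemma lift_conn:
  fixes F :: "('a cut, 'k::field) mpoly set"
  assumes B: "B \<subseteq> fibre_pairs (add_edge u v GL)" "\<And>n n'. (n, n') \<in> B \<Longrightarrow> monom n - monom n' \<in> F"
    and Q: "Q \<in> cut_monomials G" and c: "(image_mset restrL Q, P) \<in> conn B"
  obtains Q' where "Q' \<in> cut_monomials G" "image_mset restrL Q' = P"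
    "image_mset restrR Q' = image_mset restrR Q" "(Q, Q') \<in> conn (lift_pairs G u v L R F)"
proof -
  have "\<exists>Q'. Q' \<in> cut_monomials G \<and> image_mset restrL Q' = P \<and>
    image_mset restrR Q' = image_mset restrR Q \<and> (Q, Q') \<in> conn (lift_pairs G u v L R F)"
    using c unfolding conn_def[of B]
  proof (induction rule: rtrancl_induct)
    case base
    then show ?case using Q by auto
  next
    case (step y z)
    then obtain Q' where Q': "Q' \<in> cut_monomials G" "image_mset restrL Q' = y"
      "image_mset restrR Q' = image_mset restrR Q" "(Q, Q') \<in> conn (lift_pairs G u v L R F)" by blast
    obtain p n n' where pn: "y = p + n" "z = p + n'" "(n, n') \<in> B \<or> (n', n) \<in> B"
      using step(2) unfolding moves_def by blast
    have "(n, n') \<in> fibre_pairs (add_edge u v GL)" using pn(3) B(1) fibre_pairs_sym by blast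
    then have n: "n' \<in> cut_monomials GL" "image_mset sep n = image_mset sep n'"
      unfolding fibre_pairs_add_edge profile_eq_iff by (auto simp: fibre_pairs_def)
    have "monom n - monom n' \<in> F \<or> monom n' - monom n \<in> F" using pn(3) B(2) by blast
    from lift_step[OF Q'(1) Q'(2)[unfolded pn(1)] n this]
    obtain Q'' where "Q'' \<in> cut_monomials G" "image_mset restrL Q'' = p + n'"
      "image_mset restrR Q'' = image_mset restrR Q'" "(Q', Q'') \<in> conn (lift_pairs G u v L R F)" .
    then show ?case using Q' pn(2) conn_trans by metis
  qed
  with that show thesis by blast
qed

end

section \<open>Connecting the fibres of the glued graph\<close>

lemma binomials_Un: "binomials (A \<union> B) = binomials A \<union> binomials B"
  unfolding binomials_def by (rule image_Un)

text \<open>\<open>P\<close> carries a property of the chosen monomials over to the pairs: slow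
  variation in one application, \<open>True\<close> in the other.\<close>

lemma generating_pairs:
  fixes F :: "('a cut, 'k::field) mpoly set"
  assumes fin: "finite (edges G)" and ne: "edges G \<noteq> {}" and gen: "generates_cut_ideal F G"
    and F: "\<And>f. f \<in> F \<Longrightarrow> \<exists>m \<in> cut_monomials G. \<exists>m' \<in> cut_monomials G.
      size m = size m' \<and> f = monom m - monom m' \<and> P m m'"
  obtains B where "B \<subseteq> fibre_pairs G" "F = binomials B" "fibre_pairs G \<subseteq> conn B"
    "\<And>m m'. (m, m') \<in> B \<Longrightarrow> P m m'"
proof -
  define B where "B = {(m, m'). m \<in> cut_monomials G \<and> m' \<in> cut_monomials G \<and>
    monom m - monom m' \<in> F \<and> P m m'}"
  have "F \<subseteq> cut_ideal G"
    using gen Idl_poly_ring_self[of F] unfolding generates_cut_ideal_def by metis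
  have B: "B \<subseteq> fibre_pairs G"
  proof (rule subrelI)
    fix m m' assume "(m, m') \<in> B"
    then have m: "m \<in> cut_monomials G" "monom m - monom m' \<in> F" by (auto simp: B_def)
    with \<open>F \<subseteq> cut_ideal G\<close> have "monom m - monom m' \<in> (cut_ideal G :: ('a cut, 'k) mpoly set)"
      by blast
    then show "(m, m') \<in> fibre_pairs G"
      using fibre_pairs_refl[OF m(1)] by (auto simp: monom_diff_mem_cut_ideal[OF fin ne])
  qed
  have FB: "F = binomials B"
  proof
    show "F \<subseteq> binomials B"
    proof
      fix f assume "f \<in> F"
      with F[OF this] show "f \<in> binomials B"
        unfolding mem_binomials B_def by auto
    qed
    show "binomials B \<subseteq> F" unfolding binomials_def B_def by auto
  qed
  have "fibre_pairs G \<subseteq> conn B"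
    using gen unfolding FB by (simp only: binomials_generate_iff[OF fin ne B])
  moreover have "P m m'" if "(m, m') \<in> B" for m m'
    using that unfolding B_def by simp
  ultimately show thesis using B FB by (intro that)
qed

lemma slow_varying_pairs:
  assumes "finite (edges G)" "edges G \<noteq> {}" "slow_varying_generators u v G F"
  obtains B where "B \<subseteq> fibre_pairs G" "F = binomials B" "fibre_pairs G \<subseteq> conn B"
    "\<forall>m m'. (m, m') \<in> B \<longrightarrow> \<bar>int (height u v m) - int (height u v m')\<bar> \<le> 2"
proof -
  have gen: "generates_cut_ideal F G" and F: "\<And>f. f \<in> F \<Longrightarrow> \<exists>m \<in> cut_monomials G.
      \<exists>m' \<in> cut_monomials G. size m = size m' \<and> f = monom m - monom m' \<and>
        \<bar>int (height u v m) - int (height u v m')\<bar> \<le> 2"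
    using assms(3) by (simp_all add: slow_varying_generators_def)
  show thesis
  proof (rule generating_pairs[OF assms(1,2) gen F])
    fix B assume B: "B \<subseteq> fibre_pairs G" "F = binomials B" "fibre_pairs G \<subseteq> conn B"
      and h: "\<And>m m'. (m, m') \<in> B \<Longrightarrow> \<bar>int (height u v m) - int (height u v m')\<bar> \<le> 2"
    show thesis by (rule that[OF B]) (intro allI impI h)
  qed
qed

lemma binomial_generator_pairs:
  assumes "finite (edges G)" "edges G \<noteq> {}" "binomial_generators G F"
  obtains B where "B \<subseteq> fibre_pairs G" "F = binomials B" "fibre_pairs G \<subseteq> conn B"
proof -
  have gen: "generates_cut_ideal F G" and F: "\<And>f. f \<in> F \<Longrightarrow> \<exists>m \<in> cut_monomials G.
      \<exists>m' \<in> cut_monomials G. size m = size m' \<and> f = monom m - monom m' \<and> True"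
    using assms(3) by (simp_all add: binomial_generators_def)
  show thesis by (rule generating_pairs[OF assms(1,2) gen F]) (assumption, rule that)
qed

lemma enat_mult_2_diff_2_mono: "enat k \<le> M \<Longrightarrow> enat (2 * k - 2) \<le> 2 * M - 2"
  by (cases M) (auto simp: numeral_eq_enat)

text \<open>Distinct monomials do not cancel, so their degree can be read off the binomial.\<close>

lemma size_le_max_degree:
  fixes F :: "('x, 'k::field) mpoly set"
  assumes "up_to_sign F q q'" "q \<noteq> q'" "F \<subseteq> F'"
  shows "enat (size q) \<le> max_degree F'"
proof -
  have "monom q - monom q' \<in> F' \<or> monom q' - monom q \<in> F'"
    using assms(1,3) unfolding up_to_sign_def by auto
  then obtain f where "f \<in> F'" "deg f = max (size q) (size q')"
    using deg_monom_diff[OF assms(2), where 'k = 'k]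
      deg_monom_diff[OF assms(2)[symmetric], where 'k = 'k] by (metis max.commute)
  then show ?thesis
    unfolding max_degree_def by (intro SUP_upper2[of f]) simp_all
qed

context two_sum
begin

section \<open>The generators stay inside fibres\<close>

lemma simple_GL: "simple_graph GL" and simple_add_edge_GL: "simple_graph (add_edge u v GL)"
proof -
  have "finite L" using simple verts_LR by (auto simp: simple_graph_def intro: finite_subset)
  moreover have "\<exists>i \<in> L. \<exists>j \<in> L. i \<noteq> j \<and> e = {i, j}" if "e \<in> edges GL" for e
    using simple that unfolding simple_graph_def induced_def by fastforce
  ultimately show "simple_graph GL" by (simp add: simple_graph_def verts_LR)
  then show "simple_graph (add_edge u v GL)"
    using uv(1) verts_LR by (auto simp: simple_graph_def add_edge_def)
qed

lemma finite_edges: "finite (edges G)" "finite (edges GL)" "finite (edges (add_edge u v GL))"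
proof -
  have "edges G \<subseteq> Pow (verts G)" "finite (verts G)"
    using simple by (auto simp: simple_graph_def)
  then show "finite (edges G)" using finite_subset by auto
  then show "finite (edges GL)" "finite (edges (add_edge u v GL))"
    by (simp_all add: induced_def add_edge_def)
qed

lemma edges_GL_nonempty:
  assumes "is_path GL u xs v"
  shows "edges GL \<noteq> {}"
proof -
  have "Suc 0 < length xs"
  proof (rule ccontr)
    assume "\<not> Suc 0 < length xs"
    then have "hd xs = last xs" using assms by (cases xs) (auto simp: is_path_def)
    moreover have "hd xs = u" "last xs = v" using assms by (simp_all add: is_path_def)
    ultimately show False using uv(1) by simp
  qed
  then show ?thesis using assms by (auto simp: is_path_def)
qed

lemma lift_pairs_fibre:
  fixes F :: "('a cut, 'k::field) mpoly set"
  assumes "F \<subseteq> cut_ideal (add_edge u v GL)"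
  shows "lift_pairs G u v L R F \<subseteq> fibre_pairs G"
proof (rule subrelI)
  fix m m' assume "(m, m') \<in> lift_pairs G u v L R F"
  then obtain cs cs' where m: "m = mset cs" "m' = mset cs'" "set cs \<subseteq> cuts G" "set cs' \<subseteq> cuts G"
    "length cs = length cs'" "\<forall>i < length cs. restrR (cs ! i) = restrR (cs' ! i)"
    "monom (mset (map restrL cs)) - monom (mset (map restrL cs')) \<in> F"
    unfolding lift_pairs_def by blast
  have cm: "m \<in> cut_monomials G" "m' \<in> cut_monomials G" using m by (auto simp: cut_monomials_def)
  have "map restrR cs = map restrR cs'" by (rule nth_equalityI) (use m in auto)
  then have R': "image_mset restrR m = image_mset restrR m'" using m by (metis mset_map)
  have "edges (add_edge u v GL) \<noteq> {}" by (simp add: add_edge_def)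
  \<comment> \<open>The two restrictions coincide if the lifted generator is zero; reflexivity then
    replaces the fibre condition.\<close>
  from monom_diff_mem_cut_ideal[OF finite_edges(3) this, where 'k = 'k]
  have "image_mset restrL m = image_mset restrL m' \<or>
      (image_mset restrL m, image_mset restrL m') \<in> fibre_pairs (add_edge u v GL)"
    using m(7) assms m(1,2) by auto
  then have "(image_mset restrL m, image_mset restrL m') \<in> fibre_pairs GL"
    using fibre_pairs_refl[OF restr_monomialsL[OF cm(1)]] unfolding fibre_pairs_add_edge by auto
  then show "(m, m') \<in> fibre_pairs G"
    unfolding fibre_pairs_iff[OF cm] R' using fibre_pairs_refl[OF restr_monomialsR[OF cm(2)]] by blast
qed

lemma up_to_sign_fibre:
  fixes F :: "('a cut, 'k::field) mpoly set"
  assumes F: "F \<subseteq> cut_ideal GL" and ne: "edges GL \<noteq> {}" and q: "up_to_sign F q q'" "q \<noteq> q'"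
  shows "(q, q') \<in> fibre_pairs GL"
proof -
  note iff = monom_diff_mem_cut_ideal[OF finite_edges(2) ne, where 'k = 'k]
  have "monom q - monom q' \<in> F \<or> monom q' - monom q \<in> F"
    using q(1) by (simp add: up_to_sign_def)
  then show ?thesis
    using F q(2) iff[of q q'] iff[of q' q] fibre_pairs_sym by blast
qed

lemma reorder_pairs_fibre: "reorder_pairs G L R \<subseteq> fibre_pairs G"
proof (rule subrelI)
  fix m m' assume "(m, m') \<in> reorder_pairs G L R"
  then obtain C\<^sub>1 D\<^sub>1 C\<^sub>2 D\<^sub>2 C\<^sub>1' D\<^sub>1' C\<^sub>2' D\<^sub>2' where
    m: "m = {#{C\<^sub>1, D\<^sub>1}, {C\<^sub>2, D\<^sub>2}#}" "m' = {#{C\<^sub>1', D\<^sub>1'}, {C\<^sub>2', D\<^sub>2'}#}" and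
    c: "{C\<^sub>1, D\<^sub>1} \<in> cuts G" "{C\<^sub>2, D\<^sub>2} \<in> cuts G" "{C\<^sub>1', D\<^sub>1'} \<in> cuts G" "{C\<^sub>2', D\<^sub>2'} \<in> cuts G" and
    e: "C\<^sub>1 \<inter> L = C\<^sub>1' \<inter> L" "C\<^sub>2 \<inter> L = C\<^sub>2' \<inter> L" "C\<^sub>1 \<inter> R = C\<^sub>2' \<inter> R" "C\<^sub>2 \<inter> R = C\<^sub>1' \<inter> R"
    unfolding reorder_pairs_def by auto
  have D: "D = verts G - C" if "{C, D} \<in> cuts G" for C D
    using that by (auto simp: cuts_def doubleton_eq_iff)
  have "restrL {C\<^sub>1, D\<^sub>1} = restrL {C\<^sub>1', D\<^sub>1'}" "restrL {C\<^sub>2, D\<^sub>2} = restrL {C\<^sub>2', D\<^sub>2'}"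
    "restrR {C\<^sub>1, D\<^sub>1} = restrR {C\<^sub>2', D\<^sub>2'}" "restrR {C\<^sub>2, D\<^sub>2} = restrR {C\<^sub>1', D\<^sub>1'}"
    unfolding D[OF c(1)] D[OF c(2)] D[OF c(3)] D[OF c(4)] restrict_cut_eq[OF verts_LR(5)]
      restrict_cut_eq[OF verts_LR(6)]
    using e by (metis Diff_Int2 Int_absorb Int_commute Diff_Int_distrib2 Diff_Int)+
  then have "image_mset restrL m = image_mset restrL m'" "image_mset restrR m = image_mset restrR m'"
    unfolding m by (simp_all add: add_mset_commute)
  moreover have cm: "m \<in> cut_monomials G" "m' \<in> cut_monomials G"
    using c by (simp_all add: m cut_monomials_def)
  ultimately show "(m, m') \<in> fibre_pairs G"
    using fibre_pairs_iff[OF cm] fibre_pairs_refl[OF restr_monomialsL[OF cm(2)]]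
      fibre_pairs_refl[OF restr_monomialsR[OF cm(2)]] by simp
qed

end

context two_sum
begin

interpretation swap: two_sum G u v R L by (rule two_sum_swap)

lemma join_pairs_fibre:
  fixes F\<^sub>L F\<^sub>R :: "('a cut, 'k::field) mpoly set"
  assumes "F\<^sub>L \<subseteq> cut_ideal GL" "edges GL \<noteq> {}" "F\<^sub>R \<subseteq> cut_ideal GR" "edges GR \<noteq> {}"
  shows "join_pairs G u v L R F\<^sub>L F\<^sub>R \<subseteq> fibre_pairs G"
proof (rule subrelI)
  fix Q Q' assume "(Q, Q') \<in> join_pairs G u v L R F\<^sub>L F\<^sub>R"
  then obtain q\<^sub>1 q\<^sub>2 q\<^sub>3 q\<^sub>4 p r where
    up: "up_to_sign F\<^sub>L q\<^sub>1 q\<^sub>2" "up_to_sign F\<^sub>R q\<^sub>3 q\<^sub>4" and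
    h: "\<bar>int (height u v q\<^sub>1) - int (height u v q\<^sub>2)\<bar> = 2" "\<bar>int (height u v q\<^sub>3) - int (height u v q\<^sub>4)\<bar> = 2" and
    cm: "Q \<in> cut_monomials G" "Q' \<in> cut_monomials G" and
    pr: "p \<in> cut_monomials GL" "r \<in> cut_monomials GR" and
    im: "image_mset restrL Q = p + q\<^sub>1" "image_mset restrL Q' = p + q\<^sub>2"
      "image_mset restrR Q = r + q\<^sub>3" "image_mset restrR Q' = r + q\<^sub>4"
    unfolding join_pairs_def is_join_def by auto
  have "(q\<^sub>1, q\<^sub>2) \<in> fibre_pairs GL"
    using h(1) by (intro up_to_sign_fibre[OF assms(1,2) up(1)]) auto
  moreover have "(q\<^sub>3, q\<^sub>4) \<in> fibre_pairs GR"
    using h(2) by (intro swap.up_to_sign_fibre[OF assms(3,4) up(2)]) auto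
  ultimately show "(Q, Q') \<in> fibre_pairs G"
    using fibre_pairs_iff[OF cm] fibre_pairs_add_iff fibre_pairs_refl pr unfolding im by metis
qed

text \<open>A lift from one side does not touch the restriction to the other, so the sides are
  adjusted one after the other. After that only the matching of the halves can be wrong.\<close>

lemma equal_height_conn:
  fixes F\<^sub>L\<^sub>u\<^sub>v F\<^sub>R\<^sub>u\<^sub>v :: "('a cut, 'k::field) mpoly set"
  assumes BL: "B\<^sub>L \<subseteq> fibre_pairs (add_edge u v GL)" "fibre_pairs (add_edge u v GL) \<subseteq> conn B\<^sub>L"
    "F\<^sub>L\<^sub>u\<^sub>v = binomials B\<^sub>L"
    and BR: "B\<^sub>R \<subseteq> fibre_pairs (add_edge u v GR)" "fibre_pairs (add_edge u v GR) \<subseteq> conn B\<^sub>R"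
    "F\<^sub>R\<^sub>u\<^sub>v = binomials B\<^sub>R"
    and Q: "(Q, Q') \<in> fibre_pairs G" "height u v Q = height u v Q'"
  shows "(Q, Q') \<in> conn (lift_pairs G u v L R F\<^sub>L\<^sub>u\<^sub>v \<union> lift_pairs G u v R L F\<^sub>R\<^sub>u\<^sub>v \<union> reorder_pairs G L R)"
    (is "_ \<in> conn ?A")
proof -
  have cm: "Q \<in> cut_monomials G" "Q' \<in> cut_monomials G" using fibre_pairs_monomials[OF Q(1)] by auto
  have fp: "(image_mset restrL Q, image_mset restrL Q') \<in> conn B\<^sub>L"
    "(image_mset restrR Q, image_mset restrR Q') \<in> conn B\<^sub>R"
    using Q fibre_pairs_iff[OF cm] BL(2) BR(2) cm
    by (auto simp: subset_iff fibre_pairs_add_edge height_restrL height_restrR)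
  have b: "monom n - monom n' \<in> F\<^sub>L\<^sub>u\<^sub>v" if "(n, n') \<in> B\<^sub>L" for n n'
    using that unfolding BL(3) mem_binomials by blast
  have b': "monom n - monom n' \<in> F\<^sub>R\<^sub>u\<^sub>v" if "(n, n') \<in> B\<^sub>R" for n n'
    using that unfolding BR(3) mem_binomials by blast
  obtain Q\<^sub>1 where Q1: "Q\<^sub>1 \<in> cut_monomials G" "image_mset restrL Q\<^sub>1 = image_mset restrL Q'"
    "image_mset restrR Q\<^sub>1 = image_mset restrR Q" "(Q, Q\<^sub>1) \<in> conn (lift_pairs G u v L R F\<^sub>L\<^sub>u\<^sub>v)"
    using lift_conn[OF BL(1) b cm(1) fp(1)] by blast
  obtain Q\<^sub>2 where Q2: "Q\<^sub>2 \<in> cut_monomials G" "image_mset restrR Q\<^sub>2 = image_mset restrR Q'"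
    "image_mset restrL Q\<^sub>2 = image_mset restrL Q\<^sub>1" "(Q\<^sub>1, Q\<^sub>2) \<in> conn (lift_pairs G u v R L F\<^sub>R\<^sub>u\<^sub>v)"
    using swap.lift_conn[OF BR(1) b' Q1(1) fp(2)[folded Q1(3)]] by blast
  have "(Q\<^sub>2, Q') \<in> conn (reorder_pairs G L R)"
    using Q1 Q2 cm by (intro reorder_conn) simp_all
  moreover have "conn (lift_pairs G u v L R F\<^sub>L\<^sub>u\<^sub>v) \<subseteq> conn ?A" "conn (lift_pairs G u v R L F\<^sub>R\<^sub>u\<^sub>v) \<subseteq> conn ?A"
    "conn (reorder_pairs G L R) \<subseteq> conn ?A"
    by (intro conn_mono; blast)+
  ultimately show ?thesis using Q1(4) Q2(4) by (meson conn_trans subsetD)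
qed

text \<open>Only as many further factors are used as are needed to make the heights and degrees of the
  two generators agree. Since the heights of both generators increase by 2, each of them has at
  least two factors not separating \<open>u\<close> and \<open>v\<close>, which keeps the degree of the join at most
  \<open>2 * M - 2\<close>.\<close>

lemma join_step:
  fixes F\<^sub>L F\<^sub>R :: "('a cut, 'k::field) mpoly set"
  assumes up: "up_to_sign F\<^sub>L q\<^sub>1 q\<^sub>2" "up_to_sign F\<^sub>R q\<^sub>3 q\<^sub>4"
    and fp: "(q\<^sub>1, q\<^sub>2) \<in> fibre_pairs GL" "(q\<^sub>3, q\<^sub>4) \<in> fibre_pairs GR"
    and h: "height u v q\<^sub>2 = height u v q\<^sub>1 + 2" "height u v q\<^sub>4 = height u v q\<^sub>3 + 2"
    and pr: "p \<in> cut_monomials GL" "r \<in> cut_monomials GR"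
    and eq: "size (p + q\<^sub>1) = size (r + q\<^sub>3)" "height u v (p + q\<^sub>1) = height u v (r + q\<^sub>3)"
  obtains N N' where "N \<in> cut_monomials G" "N' \<in> cut_monomials G"
    "image_mset restrL N = p + q\<^sub>1" "image_mset restrR N = r + q\<^sub>3"
    "image_mset restrL N' = p + q\<^sub>2" "image_mset restrR N' = r + q\<^sub>4"
    "(N, N') \<in> conn (join_pairs G u v L R F\<^sub>L F\<^sub>R)"
proof -
  let ?h = "height u v"
  let ?n = "\<lambda>m. size (filter_mset (\<lambda>c. \<not> sep c) m)"
  have hn: "?h m + ?n m = size m" for m
    unfolding height_def by (metis multiset_partition size_union)
  have add_n: "?n (m + m') = ?n m + ?n m'" for m m' by simp
  \<comment> \<open>\<open>a\<close> and \<open>b\<close> are the least numbers of separating and of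
    non-separating factors that accommodate both \<open>q\<^sub>1\<close> and
    \<open>q\<^sub>3\<close>; the join has degree \<open>a + b\<close>.\<close>
  define a where "a = max (?h q\<^sub>1) (?h q\<^sub>3)"
  define b where "b = max (?n q\<^sub>1) (?n q\<^sub>3)"
  have eqn: "?n p + ?n q\<^sub>1 = ?n r + ?n q\<^sub>3" and eqh: "?h p + ?h q\<^sub>1 = ?h r + ?h q\<^sub>3"
    using eq hn[of "p + q\<^sub>1"] hn[of "r + q\<^sub>3"] unfolding add_n height_add by simp_all
  \<comment> \<open>The deficit of \<open>q\<^sub>1\<close> in height is 0 or
    \<open>?h q\<^sub>3 - ?h q\<^sub>1 = ?h p - ?h r\<close>, which \<open>p\<close> can cover; the
    other three bounds are analogous.\<close>
  have "a - ?h q\<^sub>1 \<le> ?h p" "b - ?n q\<^sub>1 \<le> ?n p" "a - ?h q\<^sub>3 \<le> ?h r" "b - ?n q\<^sub>3 \<le> ?n r"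
    using eqn eqh unfolding a_def b_def by linarith+
  then obtain p\<^sub>1 r\<^sub>1 where p1: "p\<^sub>1 \<subseteq># p" "?h p\<^sub>1 = a - ?h q\<^sub>1" "?n p\<^sub>1 = b - ?n q\<^sub>1"
    and r1: "r\<^sub>1 \<subseteq># r" "?h r\<^sub>1 = a - ?h q\<^sub>3" "?n r\<^sub>1 = b - ?n q\<^sub>3"
    unfolding height_def using ex_submset_size_filter[of _ sep] by metis
  obtain p\<^sub>2 r\<^sub>2 where pr2: "p = p\<^sub>2 + p\<^sub>1" "r = r\<^sub>2 + r\<^sub>1"
    using p1(1) r1(1) by (metis mset_subset_eq_exists_conv union_commute)
  have s1: "?h (p\<^sub>1 + q\<^sub>1) = a" "?h (r\<^sub>1 + q\<^sub>3) = a" "?n (p\<^sub>1 + q\<^sub>1) = b" "?n (r\<^sub>1 + q\<^sub>3) = b"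
    unfolding height_add add_n p1 r1 by (simp_all add: a_def b_def)
  then have sz: "size (p\<^sub>1 + q\<^sub>1) = a + b" "size (r\<^sub>1 + q\<^sub>3) = a + b"
    using hn[of "p\<^sub>1 + q\<^sub>1"] hn[of "r\<^sub>1 + q\<^sub>3"] by simp_all
  have q: "size q\<^sub>1 = size q\<^sub>2" "size q\<^sub>3 = size q\<^sub>4" using fp fibre_pairs_size by blast+
  have cmq: "q\<^sub>1 \<in> cut_monomials GL" "q\<^sub>2 \<in> cut_monomials GL" "q\<^sub>3 \<in> cut_monomials GR" "q\<^sub>4 \<in> cut_monomials GR"
    using fp fibre_pairs_monomials by blast+
  have cmp: "p\<^sub>1 \<in> cut_monomials GL" "p\<^sub>2 \<in> cut_monomials GL" "r\<^sub>1 \<in> cut_monomials GR" "r\<^sub>2 \<in> cut_monomials GR"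
    using pr pr2 by simp_all
  have "image_mset sep (p\<^sub>1 + q\<^sub>1) = image_mset sep (r\<^sub>1 + q\<^sub>3)"
    unfolding profile_eq_iff using s1 sz by simp
  then obtain J where J: "J \<in> cut_monomials G" "image_mset restrL J = p\<^sub>1 + q\<^sub>1" "image_mset restrR J = r\<^sub>1 + q\<^sub>3"
    using realize[of "p\<^sub>1 + q\<^sub>1" "r\<^sub>1 + q\<^sub>3"] cmq cmp by auto
  \<comment> \<open>Both heights have risen by 2 at unchanged degree, so the targets still
    match.\<close>
  have "image_mset sep (p\<^sub>1 + q\<^sub>2) = image_mset sep (r\<^sub>1 + q\<^sub>4)"
    unfolding profile_eq_iff using s1 sz h q by simp
  then obtain J' where J': "J' \<in> cut_monomials G" "image_mset restrL J' = p\<^sub>1 + q\<^sub>2" "image_mset restrR J' = r\<^sub>1 + q\<^sub>4"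
    using realize[of "p\<^sub>1 + q\<^sub>2" "r\<^sub>1 + q\<^sub>4"] cmq cmp by auto
  \<comment> \<open>What remains of the multipliers matches too, and glues to the monomial by which
    the join is multiplied.\<close>
  have "image_mset sep p\<^sub>2 = image_mset sep r\<^sub>2"
    unfolding profile_eq_iff using eq s1 sz unfolding pr2 by (simp add: add.assoc)
  then obtain K where K: "K \<in> cut_monomials G" "image_mset restrL K = p\<^sub>2" "image_mset restrR K = r\<^sub>2"
    using realize[of p\<^sub>2 r\<^sub>2] cmp by auto
  have sJ: "size J = a + b" using J(2) sz(1) by (metis size_image_mset)
  have sJ': "size J' = a + b" using J'(2) sz(1) q(1) by (metis size_image_mset size_union)
  have ne: "q\<^sub>1 \<noteq> q\<^sub>2" "q\<^sub>3 \<noteq> q\<^sub>4" using h by auto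
  let ?M = "max_degree (F\<^sub>L \<union> F\<^sub>R)"
  have "enat (size q\<^sub>1) \<le> ?M" "enat (size q\<^sub>3) \<le> ?M"
    using size_le_max_degree[OF up(1) ne(1)] size_le_max_degree[OF up(2) ne(2)] by simp_all
  then have "enat (max (size q\<^sub>1) (size q\<^sub>3)) \<le> ?M" by (simp add: max_def)
  then have "enat (2 * max (size q\<^sub>1) (size q\<^sub>3) - 2) \<le> 2 * ?M - 2" by (rule enat_mult_2_diff_2_mono)
  \<comment> \<open>If both maxima come from one generator, \<open>a + b\<close> is its degree,
    which is at least 2. Otherwise \<open>a\<close> is at most the degree of one generator minus 2,
    and \<open>b\<close> at most the degree of the other.\<close>
  moreover have "a + b \<le> 2 * max (size q\<^sub>1) (size q\<^sub>3) - 2"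
    using hn[of q\<^sub>1] hn[of q\<^sub>3] h q height_le_size[of u v q\<^sub>2] height_le_size[of u v q\<^sub>4]
    unfolding a_def b_def by linarith
  ultimately have M: "enat (size J) \<le> 2 * ?M - 2"
    unfolding sJ by (meson enat_ord_simps(1) order_trans)
  have hJ: "?h J = ?h (p\<^sub>1 + q\<^sub>1)" "?h J' = ?h (p\<^sub>1 + q\<^sub>2)"
    using height_restrL[OF J(1)] height_restrL[OF J'(1)] J(2) J'(2) by simp_all
  have "is_join G u v L R ?M q\<^sub>1 q\<^sub>2 q\<^sub>3 q\<^sub>4 J J'"
    unfolding is_join_def using J J' sJ sJ' M hJ h cmp by auto
  then have "(J, J') \<in> join_pairs G u v L R F\<^sub>L F\<^sub>R"
    unfolding join_pairs_def using up h by fastforce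
  from conn_add[OF conn_base[OF this], of K]
  show thesis
    by (rule that[rotated -1]) (use J J' K pr2 in \<open>simp_all add: add.assoc\<close>)
qed

text \<open>Induction on the gap in height: a walk at constant height leads to a monomial where the
  moves found on the two sides apply together, and the join then closes the gap by 2.\<close>

lemma fibre_pairs_conn:
  fixes F\<^sub>L F\<^sub>R F\<^sub>L\<^sub>u\<^sub>v F\<^sub>R\<^sub>u\<^sub>v :: "('a cut, 'k::field) mpoly set"
  assumes path: "is_path GL u xs v" "is_path GR u ys v"
    and BL: "B\<^sub>L \<subseteq> fibre_pairs GL" "fibre_pairs GL \<subseteq> conn B\<^sub>L" "F\<^sub>L = binomials B\<^sub>L"
      "\<And>m m'. (m, m') \<in> B\<^sub>L \<Longrightarrow> \<bar>int (height u v m) - int (height u v m')\<bar> \<le> 2"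
    and BR: "B\<^sub>R \<subseteq> fibre_pairs GR" "fibre_pairs GR \<subseteq> conn B\<^sub>R" "F\<^sub>R = binomials B\<^sub>R"
      "\<And>m m'. (m, m') \<in> B\<^sub>R \<Longrightarrow> \<bar>int (height u v m) - int (height u v m')\<bar> \<le> 2"
    and BLuv: "B\<^sub>L\<^sub>u\<^sub>v \<subseteq> fibre_pairs (add_edge u v GL)"
      "fibre_pairs (add_edge u v GL) \<subseteq> conn B\<^sub>L\<^sub>u\<^sub>v" "F\<^sub>L\<^sub>u\<^sub>v = binomials B\<^sub>L\<^sub>u\<^sub>v"
    and BRuv: "B\<^sub>R\<^sub>u\<^sub>v \<subseteq> fibre_pairs (add_edge u v GR)"
      "fibre_pairs (add_edge u v GR) \<subseteq> conn B\<^sub>R\<^sub>u\<^sub>v" "F\<^sub>R\<^sub>u\<^sub>v = binomials B\<^sub>R\<^sub>u\<^sub>v"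
  shows "fibre_pairs G \<subseteq> conn (lift_pairs G u v L R F\<^sub>L\<^sub>u\<^sub>v \<union> lift_pairs G u v R L F\<^sub>R\<^sub>u\<^sub>v
    \<union> join_pairs G u v L R F\<^sub>L F\<^sub>R \<union> reorder_pairs G L R)" (is "_ \<subseteq> conn ?A")
proof -
  let ?h = "height u v"
  have same: "(Q, Q') \<in> conn ?A" if "(Q, Q') \<in> fibre_pairs G" "?h Q = ?h Q'" for Q Q'
    by (rule subsetD[OF conn_mono equal_height_conn[OF BLuv BRuv that]]) blast
  have sgnL: "up_to_sign F\<^sub>L n n'" if "(n, n') \<in> B\<^sub>L \<or> (n', n) \<in> B\<^sub>L" for n n'
    using that unfolding up_to_sign_def BL(3) mem_binomials by (metis minus_diff_eq)
  have sgnR: "up_to_sign F\<^sub>R n n'" if "(n, n') \<in> B\<^sub>R \<or> (n', n) \<in> B\<^sub>R" for n n'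
    using that unfolding up_to_sign_def BR(3) mem_binomials by (metis minus_diff_eq)
  have up: "(Q, Q') \<in> conn ?A" if "(Q, Q') \<in> fibre_pairs G" "?h Q \<le> ?h Q'" for Q Q'
    using that
  proof (induction "?h Q' - ?h Q" arbitrary: Q rule: less_induct)
    case less
    show ?case
    proof (cases "?h Q = ?h Q'")
      case True
      then show ?thesis using same less.prems(1) by blast
    next
      case False
      with less.prems(2) have lt: "?h Q < ?h Q'" by simp
      have cm: "Q \<in> cut_monomials G" "Q' \<in> cut_monomials G"
        using fibre_pairs_monomials[OF less.prems(1)] by auto
      let ?l = "image_mset restrL" and ?r = "image_mset restrR"
      have fp: "(?l Q, ?l Q') \<in> fibre_pairs GL" "(?r Q, ?r Q') \<in> fibre_pairs GR"
        using less.prems(1) fibre_pairs_iff[OF cm] by auto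
      have hs: "?h (?l Q) = ?h Q" "?h (?l Q') = ?h Q'" "?h (?r Q) = ?h Q" "?h (?r Q') = ?h Q'"
        using cm by (simp_all add: height_restrL height_restrR)
      have par: "even (?h Q) \<longleftrightarrow> even (?h Q')"
        using even_height_fibre[OF path(1) fp(1)] hs by simp
      obtain p q\<^sub>1 q\<^sub>2 where L': "(q\<^sub>1, q\<^sub>2) \<in> B\<^sub>L \<or> (q\<^sub>2, q\<^sub>1) \<in> B\<^sub>L" "(?l Q, p + q\<^sub>1) \<in> fibre_pairs GL"
        "?h (p + q\<^sub>1) = ?h Q" "?h (p + q\<^sub>2) = ?h Q + 2"
        using conn_height_jump[OF BL(1,4) path(1) subsetD[OF BL(2) fp(1)]] lt hs
          restr_monomialsL[OF cm(1)] by metis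
      obtain r q\<^sub>3 q\<^sub>4 where R': "(q\<^sub>3, q\<^sub>4) \<in> B\<^sub>R \<or> (q\<^sub>4, q\<^sub>3) \<in> B\<^sub>R" "(?r Q, r + q\<^sub>3) \<in> fibre_pairs GR"
        "?h (r + q\<^sub>3) = ?h Q" "?h (r + q\<^sub>4) = ?h Q + 2"
        using conn_height_jump[OF BR(1,4) path(2) subsetD[OF BR(2) fp(2)]] lt hs
          restr_monomialsR[OF cm(1)] by metis
      have q: "(q\<^sub>1, q\<^sub>2) \<in> fibre_pairs GL" "(q\<^sub>3, q\<^sub>4) \<in> fibre_pairs GR"
        using L'(1) R'(1) BL(1) BR(1) fibre_pairs_sym by blast+
      have pr: "p \<in> cut_monomials GL" "r \<in> cut_monomials GR"
        using fibre_pairs_monomials[OF L'(2)] fibre_pairs_monomials[OF R'(2)] by simp_all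
      have hh: "?h q\<^sub>2 = ?h q\<^sub>1 + 2" "?h q\<^sub>4 = ?h q\<^sub>3 + 2" using L'(3,4) R'(3,4) by simp_all
      have sz: "size (p + q\<^sub>1) = size (r + q\<^sub>3)"
        using fibre_pairs_size[OF L'(2)] fibre_pairs_size[OF R'(2)] by simp
      have hpr: "?h (p + q\<^sub>1) = ?h (r + q\<^sub>3)" using L'(3) R'(3) by simp
      \<comment> \<open>The moves on the two sides come from unrelated walks, but both start at the
        degree and height of \<open>Q\<close>; this is what lets their starting monomials be
        glued.\<close>
      obtain N N' where N: "N \<in> cut_monomials G" "N' \<in> cut_monomials G"
        "?l N = p + q\<^sub>1" "?r N = r + q\<^sub>3" "?l N' = p + q\<^sub>2" "?r N' = r + q\<^sub>4"
        "(N, N') \<in> conn (join_pairs G u v L R F\<^sub>L F\<^sub>R)"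
        using join_step[OF sgnL[OF L'(1)] sgnR[OF R'(1)] q hh pr sz hpr] by blast
      have hN: "?h N = ?h Q" "?h N' = ?h Q + 2"
        using height_restrL[OF N(1)] height_restrL[OF N(2)] N(3,5) L'(3,4) by simp_all
      have QN: "(Q, N) \<in> fibre_pairs G"
        unfolding fibre_pairs_iff[OF cm(1) N(1)] N(3,4) using L'(2) R'(2) by blast
      have NN': "(N, N') \<in> fibre_pairs G"
        unfolding fibre_pairs_iff[OF N(1,2)] N(3-6)
        using fibre_pairs_add_iff[OF q(1)] fibre_pairs_add_iff[OF q(2)] pr fibre_pairs_refl by blast
      have "(Q, N) \<in> conn ?A" using same[OF QN] hN by simp
      moreover have "(N, N') \<in> conn ?A" by (rule subsetD[OF conn_mono N(7)]) blast
      moreover have "(N', Q') \<in> conn ?A"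
      proof (rule less.hyps)
        show "(N', Q') \<in> fibre_pairs G"
          using QN NN' less.prems(1) fibre_pairs_sym fibre_pairs_trans by meson
        \<comment> \<open>Equal parity turns a positive gap into one of at least 2, so the join does
          not overshoot.\<close>
        have "Suc (?h Q) \<noteq> ?h Q'" using par by (metis even_Suc)
        with lt hN show "?h N' \<le> ?h Q'" by simp
        then show "?h Q' - ?h N' < ?h Q' - ?h Q" using hN by simp
      qed
      ultimately show ?thesis by (meson conn_trans)
    qed
  qed
  show ?thesis
  proof (rule subrelI)
    fix Q Q' assume "(Q, Q') \<in> fibre_pairs G"
    then show "(Q, Q') \<in> conn ?A"
      using up[of Q Q'] conn_sym[OF up[of Q' Q]] fibre_pairs_sym[of Q Q' G] by (meson nle_le)
  qed
qed

end

section \<open>The degree bound\<close>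

text \<open>As \<open>u\<close> and \<open>v\<close> are not adjacent, replacing the cuts around \<open>u\<close> and around \<open>v\<close> by the cut
  around both and the empty cut stays in the fibre and changes the height by 2, whereas moves of
  degree at most 1 preserve heights.\<close>

lemma mu_ge_2:
  assumes H: "simple_graph H" "is_path H u xs v" and uv: "u \<noteq> v" "{u, v} \<notin> edges H" "edges H \<noteq> {}"
  shows "2 \<le> mu TYPE('k::field) H"
proof (rule ccontr)
  assume "\<not> ?thesis"
  then have mu: "mu TYPE('k) H \<le> 1" by simp
  let ?V = "verts H"
  let ?c = "\<lambda>A. {A, ?V - A}"
  have "hd xs \<in> set xs" "last xs \<in> set xs" using H(2) by (auto simp: is_path_def)
  then have V: "u \<in> ?V" "v \<in> ?V" using H(2) by (auto simp: is_path_def)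
  define m where "m = {#?c {u}, ?c {v}#}"
  define m' where "m' = {#?c {u, v}, ?c {}#}"
  have sub: "{u} \<subseteq> ?V" "{v} \<subseteq> ?V" "{u, v} \<subseteq> ?V" "{} \<subseteq> ?V" using V by auto
  note sepc = sub[THEN separates_cut] separates_cut[OF sub(4), simplified]
  have cuts: "?c A \<in> cuts H" if "A \<in> {{u}, {v}, {u, v}, {}}" for A
    using that sub by (auto intro!: cutsI)
  have "size (filter_mset (in_cut e) m) = size (filter_mset (in_cut e) m')" if "e \<in> edges H" for e
  proof -
    have "\<exists>i \<in> ?V. \<exists>j \<in> ?V. i \<noteq> j \<and> e = {i, j}"
      using H(1) that by (simp add: simple_graph_def)
    then obtain i j where ij: "i \<in> ?V" "j \<in> ?V" "i \<noteq> j" "e = {i, j}"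
      by blast
    \<comment> \<open>An edge other than \<open>{u, v}\<close> that meets \<open>u\<close> or
      \<open>v\<close> is separated by one factor of each monomial, any other edge by none.\<close>
    have "\<not> (i = u \<and> j = v)" "\<not> (i = v \<and> j = u)"
      using that uv(2) ij(4) by (auto simp: insert_commute)
    then show ?thesis
      unfolding ij(4) in_cut_pair_fun m_def m'_def
      using ij(1-3) uv(1) by (auto simp: sepc)
  qed
  moreover have "m \<in> cut_monomials H" "m' \<in> cut_monomials H"
    using cuts[of "{u}"] cuts[of "{v}"] cuts[of "{u, v}"] cuts[of "{}"]
    by (simp_all add: cut_monomials_def m_def m'_def)
  moreover have "size m = size m'" by (simp add: m_def m'_def)
  ultimately have fp: "(m, m') \<in> fibre_pairs H"
    by (simp add: fibre_pairs_def)
  have h: "height u v m = 2" "height u v m' = 0"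
    using uv(1) V by (auto simp: height_def m_def m'_def sepc)
  have "(m, m') \<in> conn {(m, m') \<in> fibre_pairs H. size m \<le> mu TYPE('k) H}"
    using mu_attained[OF H(1) uv(3), where 'k = 'k] fp by blast
  then have "height u v m' = height u v m"
    unfolding conn_def
  proof (induction rule: rtrancl_induct)
    case (step y z)
    then obtain p n n' where pn: "y = p + n" "z = p + n'" "(n, n') \<in> fibre_pairs H" "size n \<le> 1"
      using mu fibre_pairs_sym fibre_pairs_size unfolding moves_def by fastforce
    \<comment> \<open>In degree at most 1 a height is 0 or 1, hence determined by its
      parity.\<close>
    have "even (height u v n) \<longleftrightarrow> even (height u v n')"
      by (rule even_height_fibre[OF H(2) pn(3)])
    moreover have "height u v n \<le> 1" "height u v n' \<le> 1"
      using pn(4) fibre_pairs_size[OF pn(3)] height_le_size[of u v n] height_le_size[of u v n'] by auto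
    ultimately have "height u v n = height u v n'"
      by (cases "height u v n = 0"; cases "height u v n' = 0") (auto simp: le_Suc_eq)
    then show ?case using step pn by simp
  qed simp
  with h show False by simp
qed

text \<open>The zero polynomial is a difference of equal monomials of any degree, so its lifts have
  unbounded degree; it is kept out of \<open>F\<close> for this reason.\<close>

lemma lift_pairs_size:
  fixes F :: "('a cut, 'k::field) mpoly set"
  assumes "(m, m') \<in> lift_pairs G u v L R F" "0 \<notin> F" "\<And>f. f \<in> F \<Longrightarrow> deg f \<le> d"
  shows "size m \<le> d \<and> size m' \<le> d"
proof -
  obtain cs cs' where m: "m = mset cs" "m' = mset cs'" "length cs = length cs'"
    "monom (mset (map (restrict_cut L) cs)) - monom (mset (map (restrict_cut L) cs')) \<in> F" (is "?f \<in> F")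
    using assms(1) unfolding lift_pairs_def by blast
  have "?f \<noteq> 0" using m(4) assms(2) by metis
  then have "mset (map (restrict_cut L) cs) \<noteq> mset (map (restrict_cut L) cs')" by auto
  from deg_monom_diff[OF this, where 'k = 'k] assms(3)[OF m(4)] show ?thesis
    by (simp add: m(1-3))
qed

lemma join_pairs_size:
  fixes F\<^sub>L F\<^sub>R :: "('a cut, 'k::field) mpoly set"
  assumes "(Q, Q') \<in> join_pairs G u v L R F\<^sub>L F\<^sub>R" "\<And>f. f \<in> F\<^sub>L \<union> F\<^sub>R \<Longrightarrow> deg f \<le> d"
  shows "size Q \<le> 2 * d - 2 \<and> size Q' \<le> 2 * d - 2"
proof -
  have Q: "enat (size Q) \<le> 2 * max_degree (F\<^sub>L \<union> F\<^sub>R) - 2" "size Q = size Q'"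
    using assms(1) unfolding join_pairs_def is_join_def by auto
  have "max_degree (F\<^sub>L \<union> F\<^sub>R) \<le> enat d"
    unfolding max_degree_def by (rule SUP_least) (use assms(2) in simp)
  then obtain k where k: "max_degree (F\<^sub>L \<union> F\<^sub>R) = enat k" "k \<le> d"
    by (metis enat_ile enat_ord_simps(1))
  have "2 * max_degree (F\<^sub>L \<union> F\<^sub>R) - 2 = enat (2 * k - 2)"
    by (simp add: k(1) numeral_eq_enat)
  then have "size Q \<le> 2 * k - 2" using Q(1) by simp
  with Q(2) k(2) show ?thesis by linarith
qed

text \<open>Diagonal pairs only give trivial moves. Dropping them keeps 0 out of the generators that
  are going to be lifted.\<close>

lemma conn_remove_diagonal: "conn B \<subseteq> conn {(m, m') \<in> B. m \<noteq> m'}"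
proof (rule conn_subset, rule subrelI)
  fix m m' assume "(m, m') \<in> B"
  then show "(m, m') \<in> conn {(m, m') \<in> B. m \<noteq> m'}"
    by (cases "m = m'") (auto intro: conn_base)
qed

section \<open>The generating set of the glued graph and its degrees\<close>

context two_sum
begin

interpretation swap: two_sum G u v R L by (rule two_sum_swap)

lemma union_pairs_fibre:
  fixes F\<^sub>L F\<^sub>R F\<^sub>L\<^sub>u\<^sub>v F\<^sub>R\<^sub>u\<^sub>v :: "('a cut, 'k::field) mpoly set"
  assumes "F\<^sub>L \<subseteq> cut_ideal GL" "edges GL \<noteq> {}" "F\<^sub>R \<subseteq> cut_ideal GR" "edges GR \<noteq> {}"
    and "F\<^sub>L\<^sub>u\<^sub>v \<subseteq> cut_ideal (add_edge u v GL)" "F\<^sub>R\<^sub>u\<^sub>v \<subseteq> cut_ideal (add_edge u v GR)"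
  shows "lift_pairs G u v L R F\<^sub>L\<^sub>u\<^sub>v \<union> lift_pairs G u v R L F\<^sub>R\<^sub>u\<^sub>v
    \<union> join_pairs G u v L R F\<^sub>L F\<^sub>R \<union> reorder_pairs G L R \<subseteq> fibre_pairs G"
  using lift_pairs_fibre[OF assms(5)] swap.lift_pairs_fibre[OF assms(6)]
    join_pairs_fibre[OF assms(1-4)] reorder_pairs_fibre by blast

lemma union_generates:
  fixes F\<^sub>L F\<^sub>R F\<^sub>L\<^sub>u\<^sub>v F\<^sub>R\<^sub>u\<^sub>v :: "('a cut, 'k::field) mpoly set"
  assumes path: "is_path GL u xs v" "is_path GR u ys v"
    and FL: "slow_varying_generators u v GL F\<^sub>L" and FR: "slow_varying_generators u v GR F\<^sub>R"
    and FLuv: "binomial_generators (add_edge u v GL) F\<^sub>L\<^sub>u\<^sub>v"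
    and FRuv: "binomial_generators (add_edge u v GR) F\<^sub>R\<^sub>u\<^sub>v"
  shows "generates_cut_ideal (lifts G u v L R F\<^sub>L\<^sub>u\<^sub>v \<union> lifts G u v R L F\<^sub>R\<^sub>u\<^sub>v
      \<union> joins G u v L R F\<^sub>L F\<^sub>R \<union> reorderings G L R) G"
proof -
  have ne: "edges GL \<noteq> {}" "edges GR \<noteq> {}"
    "edges (add_edge u v GL) \<noteq> {}" "edges (add_edge u v GR) \<noteq> {}"
    using edges_GL_nonempty[OF path(1)] swap.edges_GL_nonempty[OF path(2)]
    by (simp_all add: add_edge_def)
  have neG: "edges G \<noteq> {}" using ne(1) by (auto simp: induced_def)
  obtain B\<^sub>L where BL: "B\<^sub>L \<subseteq> fibre_pairs GL" "F\<^sub>L = binomials B\<^sub>L" "fibre_pairs GL \<subseteq> conn B\<^sub>L"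
    "\<forall>m m'. (m, m') \<in> B\<^sub>L \<longrightarrow> \<bar>int (height u v m) - int (height u v m')\<bar> \<le> 2"
    using slow_varying_pairs[OF finite_edges(2) ne(1) FL] .
  obtain B\<^sub>R where BR: "B\<^sub>R \<subseteq> fibre_pairs GR" "F\<^sub>R = binomials B\<^sub>R" "fibre_pairs GR \<subseteq> conn B\<^sub>R"
    "\<forall>m m'. (m, m') \<in> B\<^sub>R \<longrightarrow> \<bar>int (height u v m) - int (height u v m')\<bar> \<le> 2"
    using slow_varying_pairs[OF swap.finite_edges(2) ne(2) FR] .
  obtain B\<^sub>L\<^sub>u\<^sub>v where BLuv: "B\<^sub>L\<^sub>u\<^sub>v \<subseteq> fibre_pairs (add_edge u v GL)" "F\<^sub>L\<^sub>u\<^sub>v = binomials B\<^sub>L\<^sub>u\<^sub>v"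
    "fibre_pairs (add_edge u v GL) \<subseteq> conn B\<^sub>L\<^sub>u\<^sub>v"
    by (rule binomial_generator_pairs[OF finite_edges(3) ne(3) FLuv])
  obtain B\<^sub>R\<^sub>u\<^sub>v where BRuv: "B\<^sub>R\<^sub>u\<^sub>v \<subseteq> fibre_pairs (add_edge u v GR)" "F\<^sub>R\<^sub>u\<^sub>v = binomials B\<^sub>R\<^sub>u\<^sub>v"
    "fibre_pairs (add_edge u v GR) \<subseteq> conn B\<^sub>R\<^sub>u\<^sub>v"
    by (rule binomial_generator_pairs[OF swap.finite_edges(3) ne(4) FRuv])
  let ?A = "lift_pairs G u v L R F\<^sub>L\<^sub>u\<^sub>v \<union> lift_pairs G u v R L F\<^sub>R\<^sub>u\<^sub>v
    \<union> join_pairs G u v L R F\<^sub>L F\<^sub>R \<union> reorder_pairs G L R"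
  have "?A \<subseteq> fibre_pairs G"
  proof (rule union_pairs_fibre[OF _ ne(1) _ ne(2)])
    show "F\<^sub>L \<subseteq> cut_ideal GL"
      unfolding BL(2) by (rule binomials_subset_cut_ideal[OF finite_edges(2) ne(1) BL(1)])
    show "F\<^sub>R \<subseteq> cut_ideal GR"
      unfolding BR(2) by (rule binomials_subset_cut_ideal[OF swap.finite_edges(2) ne(2) BR(1)])
    show "F\<^sub>L\<^sub>u\<^sub>v \<subseteq> cut_ideal (add_edge u v GL)"
      unfolding BLuv(2) by (rule binomials_subset_cut_ideal[OF finite_edges(3) ne(3) BLuv(1)])
    show "F\<^sub>R\<^sub>u\<^sub>v \<subseteq> cut_ideal (add_edge u v GR)"
      unfolding BRuv(2) by (rule binomials_subset_cut_ideal[OF swap.finite_edges(3) ne(4) BRuv(1)])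
  qed
  from binomials_generate_iff[OF finite_edges(1) neG this, where 'k = 'k]
    fibre_pairs_conn[OF path BL(1,3,2) BL(4)[rule_format] BR(1,3,2) BR(4)[rule_format] BLuv(1,3,2) BRuv(1,3,2)]
  show ?thesis
    by (simp add: binomials_Un lifts_eq joins_eq reorderings_eq)
qed

text \<open>Slow variation is a condition on single generators and survives the truncation at
  \<open>mu\<close>, so low degree and slow variation can be had together.\<close>

lemma ex_slow_varying_generators_deg_le_mu:
  fixes F :: "('a cut, 'k::field) mpoly set"
  assumes path: "is_path GL u xs v" and F: "slow_varying_generators u v GL F"
  obtains F' :: "('a cut, 'k) mpoly set"
    where "slow_varying_generators u v GL F'" "\<And>f. f \<in> F' \<Longrightarrow> deg f \<le> mu TYPE('k) GL"
proof -
  have ne: "edges GL \<noteq> {}" by (rule edges_GL_nonempty[OF path])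
  obtain B where B: "B \<subseteq> fibre_pairs GL" "F = binomials B" "fibre_pairs GL \<subseteq> conn B"
    "\<forall>m m'. (m, m') \<in> B \<longrightarrow> \<bar>int (height u v m) - int (height u v m')\<bar> \<le> 2"
    using slow_varying_pairs[OF finite_edges(2) ne F] .
  let ?B = "{(m, m') \<in> B. size m \<le> mu TYPE('k) GL}"
  have B': "?B \<subseteq> fibre_pairs GL" using B(1) by blast
  have "fibre_pairs GL \<subseteq> conn ?B" by (rule conn_size_le_mu[OF simple_GL ne B(1,3)])
  then have "generates_cut_ideal (binomials ?B :: ('a cut, 'k) mpoly set) GL"
    by (simp only: binomials_generate_iff[OF finite_edges(2) ne B'])
  moreover have "\<exists>m \<in> cut_monomials GL. \<exists>m' \<in> cut_monomials GL. size m = size m' \<and>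
      f = monom m - monom m' \<and> \<bar>int (height u v m) - int (height u v m')\<bar> \<le> 2"
    "deg f \<le> mu TYPE('k) GL" if f: "f \<in> binomials ?B" for f :: "('a cut, 'k) mpoly"
  proof -
    obtain m m' where m: "(m, m') \<in> ?B" "f = monom m - monom m'"
      using f unfolding mem_binomials by blast
    then have "(m, m') \<in> fibre_pairs GL" "\<bar>int (height u v m) - int (height u v m')\<bar> \<le> 2"
      using B' B(4) by blast+
    then show "\<exists>m \<in> cut_monomials GL. \<exists>m' \<in> cut_monomials GL. size m = size m' \<and>
      f = monom m - monom m' \<and> \<bar>int (height u v m) - int (height u v m')\<bar> \<le> 2"
      "deg f \<le> mu TYPE('k) GL"
      using m fibre_pairs_monomials[of m m' GL] fibre_pairs_size[of m m' GL]
      by (auto intro!: deg_monom_diff_le)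
  qed
  ultimately show thesis
    by (intro that[of "binomials ?B"]) (auto simp: slow_varying_generators_def)
qed

lemma ex_binomial_generators_deg_le_mu:
  obtains F :: "('a cut, 'k::field) mpoly set"
    where "binomial_generators (add_edge u v GL) F" "0 \<notin> F"
      "\<And>f. f \<in> F \<Longrightarrow> deg f \<le> mu TYPE('k) (add_edge u v GL)"
proof -
  let ?H = "add_edge u v GL"
  have ne: "edges ?H \<noteq> {}" by (simp add: add_edge_def)
  let ?B = "{(m, m') \<in> {(m, m') \<in> fibre_pairs ?H. size m \<le> mu TYPE('k) ?H}. m \<noteq> m'}"
  have B': "?B \<subseteq> fibre_pairs ?H" by blast
  have "fibre_pairs ?H \<subseteq> conn ?B"
    using mu_attained[OF simple_add_edge_GL ne, where 'k = 'k] conn_remove_diagonal by (rule subset_trans)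
  then have "generates_cut_ideal (binomials ?B :: ('a cut, 'k) mpoly set) ?H"
    by (simp only: binomials_generate_iff[OF finite_edges(3) ne B'])
  moreover have "\<exists>m \<in> cut_monomials ?H. \<exists>m' \<in> cut_monomials ?H. size m = size m' \<and> f = monom m - monom m'"
    "deg f \<le> mu TYPE('k) ?H" "f \<noteq> 0" if f: "f \<in> binomials ?B" for f :: "('a cut, 'k) mpoly"
  proof -
    obtain m m' where m: "(m, m') \<in> ?B" "f = monom m - monom m'"
      using f unfolding mem_binomials by blast
    then have fp: "(m, m') \<in> fibre_pairs ?H" "m \<noteq> m'" "size m \<le> mu TYPE('k) ?H" by blast+
    then show "\<exists>m \<in> cut_monomials ?H. \<exists>m' \<in> cut_monomials ?H. size m = size m' \<and> f = monom m - monom m'"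
      using m fibre_pairs_monomials fibre_pairs_size by blast
    show "deg f \<le> mu TYPE('k) ?H"
      using m(2) fp fibre_pairs_size[OF fp(1)] by (auto intro!: deg_monom_diff_le)
    show "f \<noteq> 0" using keys_monom_diff[OF fp(2), where 'k = 'k] m(2) by auto
  qed
  ultimately show thesis
    by (intro that[of "binomials ?B"]) (auto simp: binomial_generators_def)
qed

end

context two_sum
begin

interpretation swap: two_sum G u v R L by (rule two_sum_swap)

text \<open>The lower bounds serve two purposes: reorderings have degree
  \<open>2 = 2 * 2 - 2\<close>, and the truncated subtraction here agrees with the integer
  subtraction in the theorem.\<close>

lemma mu_bound:
  assumes path: "is_path GL u xs v" "is_path GR u ys v"
    and F: "slow_varying_generators u v GL (F :: ('a cut, 'k::field) mpoly set)"
      "slow_varying_generators u v GR (F' :: ('a cut, 'k) mpoly set)"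
  shows "2 \<le> mu TYPE('k) GL" "2 \<le> mu TYPE('k) GR"
    "mu TYPE('k) G \<le> max (2 * max (mu TYPE('k) GL) (mu TYPE('k) GR) - 2)
      (max (mu TYPE('k) (add_edge u v GL)) (mu TYPE('k) (add_edge u v GR)))" (is "_ \<le> ?d")
proof -
  show ge2: "2 \<le> mu TYPE('k) GL"
    using uv by (intro mu_ge_2[OF simple_GL path(1) _ _ edges_GL_nonempty[OF path(1)]])
      (auto simp: induced_def)
  show "2 \<le> mu TYPE('k) GR"
    using uv by (intro mu_ge_2[OF swap.simple_GL path(2) _ _ swap.edges_GL_nonempty[OF path(2)]])
      (auto simp: induced_def)
  obtain F\<^sub>L :: "('a cut, 'k) mpoly set" where FL: "slow_varying_generators u v GL F\<^sub>L"
    "\<And>f. f \<in> F\<^sub>L \<Longrightarrow> deg f \<le> mu TYPE('k) GL"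
    using ex_slow_varying_generators_deg_le_mu[OF path(1) F(1)] by blast
  obtain F\<^sub>R :: "('a cut, 'k) mpoly set" where FR: "slow_varying_generators u v GR F\<^sub>R"
    "\<And>f. f \<in> F\<^sub>R \<Longrightarrow> deg f \<le> mu TYPE('k) GR"
    using swap.ex_slow_varying_generators_deg_le_mu[OF path(2) F(2)] by blast
  obtain F\<^sub>L\<^sub>u\<^sub>v :: "('a cut, 'k) mpoly set" where FLuv: "binomial_generators (add_edge u v GL) F\<^sub>L\<^sub>u\<^sub>v"
    "0 \<notin> F\<^sub>L\<^sub>u\<^sub>v" "\<And>f. f \<in> F\<^sub>L\<^sub>u\<^sub>v \<Longrightarrow> deg f \<le> mu TYPE('k) (add_edge u v GL)"
    using ex_binomial_generators_deg_le_mu by blast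
  obtain F\<^sub>R\<^sub>u\<^sub>v :: "('a cut, 'k) mpoly set" where FRuv: "binomial_generators (add_edge u v GR) F\<^sub>R\<^sub>u\<^sub>v"
    "0 \<notin> F\<^sub>R\<^sub>u\<^sub>v" "\<And>f. f \<in> F\<^sub>R\<^sub>u\<^sub>v \<Longrightarrow> deg f \<le> mu TYPE('k) (add_edge u v GR)"
    using swap.ex_binomial_generators_deg_le_mu by blast
  let ?A = "lift_pairs G u v L R F\<^sub>L\<^sub>u\<^sub>v \<union> lift_pairs G u v R L F\<^sub>R\<^sub>u\<^sub>v
    \<union> join_pairs G u v L R F\<^sub>L F\<^sub>R \<union> reorder_pairs G L R"
  have "generates_cut_ideal (binomials ?A :: ('a cut, 'k) mpoly set) G"
    using union_generates[OF path FL(1) FR(1) FLuv(1) FRuv(1)]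
    by (simp add: binomials_Un lifts_eq joins_eq reorderings_eq)
  moreover have "deg f \<le> ?d" if f: "f \<in> binomials ?A" for f :: "('a cut, 'k) mpoly"
  proof -
    obtain m m' where m: "(m, m') \<in> ?A" "f = monom m - monom m'"
      using f unfolding mem_binomials by blast
    have "deg g \<le> max (mu TYPE('k) GL) (mu TYPE('k) GR)" if "g \<in> F\<^sub>L \<union> F\<^sub>R" for g
      using that FL(2) FR(2) by (auto simp: le_max_iff_disj)
    note join = join_pairs_size[OF _ this]
    from m(1) consider "(m, m') \<in> lift_pairs G u v L R F\<^sub>L\<^sub>u\<^sub>v" | "(m, m') \<in> lift_pairs G u v R L F\<^sub>R\<^sub>u\<^sub>v"
      | "(m, m') \<in> join_pairs G u v L R F\<^sub>L F\<^sub>R" | "(m, m') \<in> reorder_pairs G L R" by blast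
    then have "size m \<le> ?d \<and> size m' \<le> ?d"
    proof cases
      case 1
      from lift_pairs_size[OF this FLuv(2,3)] show ?thesis by (simp add: le_max_iff_disj)
    next
      case 2
      from lift_pairs_size[OF this FRuv(2,3)] show ?thesis by (simp add: le_max_iff_disj)
    next
      case 3
      from join[OF this] show ?thesis by (meson le_max_iff_disj)
    next
      case 4
      then have "size m = 2" "size m' = 2" unfolding reorder_pairs_def by auto
      with ge2 show ?thesis by linarith
    qed
    then show ?thesis unfolding m(2) by (intro deg_monom_diff_le) simp_all
  qed
  ultimately show "mu TYPE('k) G \<le> ?d"
    unfolding mu_def[of "TYPE('k)" G] by (intro Least_le) blast
qed

end

theorem theorem2p6:
  fixes G :: "'a graph" and u v :: 'a and L R :: "'a set"
  assumes "simple_graph G"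
    and "u \<in> verts G" and "v \<in> verts G" and "u \<noteq> v" and "{u, v} \<notin> edges G"
    and "L \<subseteq> verts G" and "R \<subseteq> verts G"
    and "L \<union> R = verts G" and "L \<inter> R = {u, v}"
    and "edges G = edges (induced G L) \<union> edges (induced G R)"
    and "\<exists>xs. is_path (induced G L) u xs v"
    and "\<exists>xs. is_path (induced G R) u xs v"
    and "\<exists>F :: ('a cut, 'k::field) mpoly set. slow_varying_generators u v (induced G L) F"
    and "\<exists>F :: ('a cut, 'k) mpoly set. slow_varying_generators u v (induced G R) F"
  shows
    "int (mu TYPE('k) G) \<le>
       Max {2 * int (mu TYPE('k) (induced G L)) - 2,
            2 * int (mu TYPE('k) (induced G R)) - 2,
            int (mu TYPE('k) (add_edge u v (induced G L))),
            int (mu TYPE('k) (add_edge u v (induced G R)))}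
     \<and> (\<forall>(F\<^sub>L :: ('a cut, 'k) mpoly set) F\<^sub>R F\<^sub>L\<^sub>u\<^sub>v F\<^sub>R\<^sub>u\<^sub>v.
          slow_varying_generators u v (induced G L) F\<^sub>L \<longrightarrow>
          slow_varying_generators u v (induced G R) F\<^sub>R \<longrightarrow>
          binomial_generators (add_edge u v (induced G L)) F\<^sub>L\<^sub>u\<^sub>v \<longrightarrow>
          binomial_generators (add_edge u v (induced G R)) F\<^sub>R\<^sub>u\<^sub>v \<longrightarrow>
          generates_cut_ideal
            (lifts G u v L R F\<^sub>L\<^sub>u\<^sub>v \<union> lifts G u v R L F\<^sub>R\<^sub>u\<^sub>v
              \<union> joins G u v L R F\<^sub>L F\<^sub>R \<union> reorderings G L R) G)"
proof -
  interpret two_sum G u v L R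
    using assms(1,4,5,8,9,10) by unfold_locales
  obtain xs ys where path: "is_path GL u xs v" "is_path GR u ys v"
    using assms(11,12) by blast
  obtain F F' :: "('a cut, 'k) mpoly set"
    where F: "slow_varying_generators u v GL F" "slow_varying_generators u v GR F'"
    using assms(13,14) by blast
  note mu = mu_bound[OF path F]
  have "int (mu TYPE('k) G) \<le> Max {2 * int (mu TYPE('k) GL) - 2, 2 * int (mu TYPE('k) GR) - 2,
      int (mu TYPE('k) (add_edge u v GL)), int (mu TYPE('k) (add_edge u v GR))}"
    using mu by simp
  then show ?thesis using union_generates[OF path] by blast
qed

end
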